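(* Let $P\subset\mathbb R^N$ be a rational polytope of dimension $M$, and let $v\in\mathbb R^N$, $\alpha\in\mathbb R$. Then: (1) $h_{P,v,\alpha}$ is a quasi-polynomial on $d\ge-\alpha$, and $h_{P,v,\alpha}(d)=0$ for $d<-\alpha$. (2) $\mathring h_{P,v,\alpha}$ is a quasi-polynomial on $d>-\alpha$, and $\mathring h_{P,v,\alpha}(d)=0$ for $d\le-\alpha$. (3) $H_{P,v,\alpha}(1/t)=(-1)^{M+1}\mathring H_{P,-v,-\alpha}(t)$ (as rational functions). (4) If $f_{P,v,\alpha}$ denotes the quasi-polynomial agreeing with $h_{P,v,\alpha}$ on $d\ge-\alpha$, then $f_{P,v,\alpha}(-i)=(-1)^M\mathring h_{P,-v,-\alpha}(i)$ for all $i\in\mathbb Z_{>\alpha}$.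
   Context: A rational polytope has vertices in $\mathbb Q^N$; $\mathrm{relint}(P)$ is its relative interior. For $d\in\mathbb Z$ define $h_{P,v,\alpha}(d):=\#\big((v+(d+\alpha)P)\cap\mathbb Z^N\big)$ and $\mathring h_{P,v,\alpha}(d):=\#\big((v+(d+\alpha)\,\mathrm{relint}(P))\cap\mathbb Z^N\big)$, with the conventions $sP=\emptyset$ for $s<0$ (so $0\cdot P=\{0\}$) and $s\cdot\mathrm{relint}(P)=\emptyset$ for $s\le0$. Their generating functions are $H_{P,v,\alpha}(t):=\sum_{i\in\mathbb Z}h_{P,v,\alpha}(i)t^i$ and $\mathring H_{P,v,\alpha}(t):=\sum_{i\in\mathbb Z}\mathring h_{P,v,\alpha}(i)t^i$. A quasi-polynomial is $f:\mathbb Z\to\mathbb C$ such that for some $N\ge1$ and polynomials $Q_0,\dots,Q_{N-1}$, $f(m)=Q_j(m)$ whenever $m\equiv j\pmod N$; a function is a quasi-polynomial on a set of integers $S$ if it agrees with a quasi-polynomial on $S$. *)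

theory Defs
  imports
    "HOL-Analysis.Analysis"
    "HOL-Computational_Algebra.Computational_Algebra"
    "HOL-Computational_Algebra.Field_as_Ring"
    "HOL-Number_Theory.Cong"
begin

definition rational_polytope :: "(real ^ 'n) set \<Rightarrow> bool" where
  "rational_polytope P \<longleftrightarrow>
     polytope P \<and> (\<forall>x. x extreme_point_of P \<longrightarrow> (\<forall>i. vec_nth x i \<in> \<rat>))"

definition int_lattice :: "(real ^ 'n) set" where
  "int_lattice = {x. \<forall>i. vec_nth x i \<in> \<int>}"

definition dilate :: "real \<Rightarrow> (real ^ 'n) set \<Rightarrow> (real ^ 'n) set" where
  "dilate s P = (if s < 0 then {} else (\<lambda>x. s *\<^sub>R x) ` P)"

definition dilate_relint :: "real \<Rightarrow> (real ^ 'n) set \<Rightarrow> (real ^ 'n) set" where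
  "dilate_relint s P = (if s \<le> 0 then {} else (\<lambda>x. s *\<^sub>R x) ` rel_interior P)"

text \<open>For bounded \<open>P\<close> the sets counted below are finite, so \<^const>\<open>card\<close> is the genuine
  number of lattice points.\<close>

definition count_pts :: "(real ^ 'n) set \<Rightarrow> real ^ 'n \<Rightarrow> real \<Rightarrow> int \<Rightarrow> nat" where
  "count_pts P v \<alpha> d = card ((\<lambda>x. v + x) ` dilate (of_int d + \<alpha>) P \<inter> int_lattice)"

definition count_relint_pts :: "(real ^ 'n) set \<Rightarrow> real ^ 'n \<Rightarrow> real \<Rightarrow> int \<Rightarrow> nat" where
  "count_relint_pts P v \<alpha> d = card ((\<lambda>x. v + x) ` dilate_relint (of_int d + \<alpha>) P \<inter> int_lattice)"

lemma eventually_neg_int_plus_neg: "\<forall>\<^sub>\<infinity>n::nat. of_int (- int n) + \<alpha> < (0::real)"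
  unfolding MOST_nat
proof (intro exI allI impI)
  fix n assume "nat \<lceil>\<alpha>\<rceil> < n"
  then show "of_int (- int n) + \<alpha> < 0" by simp linarith
qed

text \<open>The generating functions are Laurent series because both counting functions vanish at all
  sufficiently negative integers.\<close>

lift_definition gen_series :: "(real ^ 'n) set \<Rightarrow> real ^ 'n \<Rightarrow> real \<Rightarrow> complex fls"
  is "\<lambda>P v \<alpha> i. of_nat (count_pts P v \<alpha> i)"
  subgoal for P v \<alpha>
    by (rule MOST_mono[OF eventually_neg_int_plus_neg[of \<alpha>]]) (simp add: count_pts_def dilate_def)
  done

lift_definition gen_series_relint :: "(real ^ 'n) set \<Rightarrow> real ^ 'n \<Rightarrow> real \<Rightarrow> complex fls"
  is "\<lambda>P v \<alpha> i. of_nat (count_relint_pts P v \<alpha> i)"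
  subgoal for P v \<alpha>
    by (rule MOST_mono[OF eventually_neg_int_plus_neg[of \<alpha>]]) (simp add: count_relint_pts_def dilate_relint_def)
  done

definition quasi_polynomial :: "(int \<Rightarrow> complex) \<Rightarrow> bool" where
  "quasi_polynomial f \<longleftrightarrow>
     (\<exists>(N::nat) (Q :: nat \<Rightarrow> complex poly). N \<ge> 1 \<and>
        (\<forall>j<N. \<forall>m::int. [m = int j] (mod int N) \<longrightarrow> f m = poly (Q j) (of_int m)))"

definition quasi_polynomial_on :: "int set \<Rightarrow> (int \<Rightarrow> complex) \<Rightarrow> bool" where
  "quasi_polynomial_on S f \<longleftrightarrow> (\<exists>g. quasi_polynomial g \<and> (\<forall>m\<in>S. f m = g m))"

text \<open>The field of rational functions \<open>\<complex>(t)\<close> is the type \<^typ>\<open>complex poly fract\<close>. The first map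
  is its embedding into Laurent series (expansion at \<open>t = 0\<close>), the second is the substitution
  \<open>R(t) \<mapsto> R(1/t)\<close>. Both are written on the reduced fraction, but any fraction \<open>p/q\<close>
  representing \<open>R\<close> gives the same value.\<close>

definition ratfun_to_fls :: "complex poly fract \<Rightarrow> complex fls" where
  "ratfun_to_fls R = (case quot_of_fract R of (p, q) \<Rightarrow>
     fps_to_fls (fps_of_poly p) / fps_to_fls (fps_of_poly q))"

definition poly_at_inverse_t :: "complex poly \<Rightarrow> complex poly fract" where
  "poly_at_inverse_t p = poly (map_poly (\<lambda>c. to_fract [:c:]) p) (1 / to_fract [:0, 1:])"

definition ratfun_at_inverse_t :: "complex poly fract \<Rightarrow> complex poly fract" where
  "ratfun_at_inverse_t R = (case quot_of_fract R of (p, q) \<Rightarrow>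
     poly_at_inverse_t p / poly_at_inverse_t q)"

end

theory Submission
  imports Defs
begin

text \<open>
  Let \<open>C\<close> be the cone over \<open>{1} \<times> P\<close>. The numbers in question count the points of a coset of
  the lattice in \<open>C\<close>, and in the reflection of the relative interior of \<open>C\<close>, by height. Everything
  follows once the difference of the indicator of \<open>C\<close> and \<open>(-1)\<close>\<open>\<^sup>M\<^sup>+\<^sup>1\<close> times the indicator of
  \<open>- relint C\<close> is annihilated by the product of the difference operators \<open>1 - [w]\<close>, where \<open>w\<close> runs
  through integral generators of \<open>C\<close> of common height \<open>m\<close>: summing over the lattice points of a
  fixed height turns this product into a power of \<open>1 - [m]\<close>, and a function on \<open>\<int>\<close> annihilated by it
  is a quasi-polynomial.

  To prove this annihilation, add the generators one at a time. In the algebra of polyhedral indicators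
  under convolution with respect to the Euler characteristic, adding \<open>w\<close> convolves the indicator of \<open>C\<close>
  with the ray \<open>a = [\<real>\<^sub>\<ge>\<^sub>0 w]\<close> and the signed indicator of \<open>- relint C\<close> with \<open>b = - [\<real>\<^sub><\<^sub>0 w]\<close>. Since
  \<open>a - b = [\<real> w]\<close>, the new difference is the convolution of the old one with \<open>b\<close>, which commutes with
  translations, plus a function invariant under \<open>w\<close>, which \<open>1 - [w]\<close> kills. No triangulation is needed.
\<close>

section \<open>Jumps of functions of a real variable\<close>

definition left_jump :: "(real \<Rightarrow> real) \<Rightarrow> real \<Rightarrow> real" where
  "left_jump \<psi> t = Lim (at_left t) \<psi> - \<psi> t"

text \<open>For the indicator of an interval \<open>I\<close> that is bounded above, this is minus the Euler
  characteristic (with compact supports) of \<open>I \<inter> {t. t > 0}\<close>; jumps are taken from the left so that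
  no limit at infinity occurs.\<close>

definition jump_sum :: "(real \<Rightarrow> real) \<Rightarrow> real" where
  "jump_sum \<psi> = (\<Sum>t | t > 0 \<and> left_jump \<psi> t \<noteq> 0. left_jump \<psi> t)"

definition left_tame :: "(real \<Rightarrow> real) \<Rightarrow> bool" where
  "left_tame \<psi> \<longleftrightarrow> (\<forall>t. \<exists>l. (\<psi> \<longlongrightarrow> l) (at_left t)) \<and> finite {t. left_jump \<psi> t \<noteq> 0}"

lemma left_jump_eqI:
  assumes "(\<psi> \<longlongrightarrow> l) (at_left t)"
  shows "left_jump \<psi> t = l - \<psi> t"
  using tendsto_Lim[OF _ assms] by (simp add: left_jump_def)

lemma left_tame_tendsto:
  assumes "left_tame \<psi>"
  shows "(\<psi> \<longlongrightarrow> \<psi> t + left_jump \<psi> t) (at_left t)"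
proof -
  obtain l where "(\<psi> \<longlongrightarrow> l) (at_left t)"
    using assms unfolding left_tame_def by blast
  then show ?thesis
    by (simp add: left_jump_eqI)
qed

lemma left_jump_diff:
  assumes "left_tame \<psi>" "left_tame \<theta>"
  shows "left_jump (\<lambda>t. \<psi> t - \<theta> t) t = left_jump \<psi> t - left_jump \<theta> t"
  using left_jump_eqI[OF tendsto_diff[OF assms[THEN left_tame_tendsto]]] by simp

lemma left_jump_cmult:
  assumes "left_tame \<psi>"
  shows "left_jump (\<lambda>t. c * \<psi> t) t = c * left_jump \<psi> t"
  using left_jump_eqI[OF tendsto_mult_left[OF left_tame_tendsto[OF assms]]] by (simp add: algebra_simps)

lemma left_tame_diff:
  assumes "left_tame \<psi>" "left_tame \<theta>"
  shows "left_tame (\<lambda>t. \<psi> t - \<theta> t)"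
  unfolding left_tame_def
proof (intro conjI allI)
  show "\<exists>l. ((\<lambda>t. \<psi> t - \<theta> t) \<longlongrightarrow> l) (at_left t)" for t
    using tendsto_diff[OF assms[THEN left_tame_tendsto]] by blast
  have "{t. left_jump (\<lambda>t. \<psi> t - \<theta> t) t \<noteq> 0} \<subseteq> {t. left_jump \<psi> t \<noteq> 0} \<union> {t. left_jump \<theta> t \<noteq> 0}"
    by (auto simp: left_jump_diff[OF assms])
  then show "finite {t. left_jump (\<lambda>t. \<psi> t - \<theta> t) t \<noteq> 0}"
    by (rule finite_subset) (use assms in \<open>simp add: left_tame_def\<close>)
qed

lemma left_tame_cmult:
  assumes "left_tame \<psi>"
  shows "left_tame (\<lambda>t. c * \<psi> t)"
  unfolding left_tame_def
proof (intro conjI allI)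
  show "\<exists>l. ((\<lambda>t. c * \<psi> t) \<longlongrightarrow> l) (at_left t)" for t
    using tendsto_mult_left[OF left_tame_tendsto[OF assms]] by blast
  have "{t. left_jump (\<lambda>t. c * \<psi> t) t \<noteq> 0} \<subseteq> {t. left_jump \<psi> t \<noteq> 0}"
    by (auto simp: left_jump_cmult[OF assms])
  then show "finite {t. left_jump (\<lambda>t. c * \<psi> t) t \<noteq> 0}"
    by (rule finite_subset) (use assms in \<open>simp add: left_tame_def\<close>)
qed

lemma jump_sum_eq_sum:
  assumes "finite A" "A \<subseteq> {0<..}" "{t. t > 0 \<and> left_jump \<psi> t \<noteq> 0} \<subseteq> A"
  shows "jump_sum \<psi> = sum (left_jump \<psi>) A"
  unfolding jump_sum_def using assms by (intro sum.mono_neutral_left) auto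

lemma jump_sum_diff:
  assumes "left_tame \<psi>" "left_tame \<theta>"
  shows "jump_sum (\<lambda>t. \<psi> t - \<theta> t) = jump_sum \<psi> - jump_sum \<theta>"
proof -
  define A where "A = {t. t > 0 \<and> (left_jump \<psi> t \<noteq> 0 \<or> left_jump \<theta> t \<noteq> 0)}"
  have "A \<subseteq> {t. left_jump \<psi> t \<noteq> 0} \<union> {t. left_jump \<theta> t \<noteq> 0}"
    by (auto simp: A_def)
  then have "finite A"
    by (rule finite_subset) (use assms in \<open>simp add: left_tame_def\<close>)
  then have "jump_sum (\<lambda>t. \<psi> t - \<theta> t) = sum (left_jump (\<lambda>t. \<psi> t - \<theta> t)) A"
      "jump_sum \<psi> = sum (left_jump \<psi>) A" "jump_sum \<theta> = sum (left_jump \<theta>) A"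
    by ((rule jump_sum_eq_sum; auto simp: A_def left_jump_diff[OF assms])+)
  then show ?thesis
    by (simp add: left_jump_diff[OF assms] sum_subtractf)
qed

lemma jump_sum_cmult:
  assumes "left_tame \<psi>"
  shows "jump_sum (\<lambda>t. c * \<psi> t) = c * jump_sum \<psi>"
  by (cases "c = 0") (simp_all only: jump_sum_def left_jump_cmult[OF assms], simp_all add: sum_distrib_left)

subsection \<open>Indicators of intervals\<close>

definition upper_end :: "real set \<Rightarrow> real \<Rightarrow> bool" where
  "upper_end I t \<longleftrightarrow> t \<notin> I \<and> (\<forall>\<^sub>F s in at_left t. s \<in> I)"

definition lower_end :: "real set \<Rightarrow> real \<Rightarrow> bool" where
  "lower_end I t \<longleftrightarrow> t \<in> I \<and> (\<forall>\<^sub>F s in at_left t. s \<notin> I)"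

lemma eventually_at_left_imp_ex:
  fixes c t :: real
  assumes "\<forall>\<^sub>F s in at_left t. Q s" "c < t"
  shows "\<exists>s. c < s \<and> s < t \<and> Q s"
proof -
  have "\<forall>\<^sub>F s in at_left t. Q s \<and> s \<in> {c<..<t}"
    using assms eventually_at_left_real by (intro eventually_conj)
  then show ?thesis
    using eventually_happens'[OF trivial_limit_at_left_real] by auto
qed

lemma eventually_at_left_in_open:
  fixes t :: real
  assumes "open S" "t \<in> S"
  shows "\<forall>\<^sub>F s in at_left t. s \<in> S"
  using eventually_nhds_in_open[OF assms] by (simp add: eventually_at_filter eventually_mono)

lemma eventually_at_left_is_interval:
  fixes I :: "real set"
  assumes "is_interval I"
  shows "(\<forall>\<^sub>F s in at_left t. s \<in> I) \<or> (\<forall>\<^sub>F s in at_left t. s \<notin> I)"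
proof (rule disjCI)
  assume "\<not> (\<forall>\<^sub>F s in at_left t. s \<notin> I)"
  then have accumulates: "\<exists>s\<in>I. a < s \<and> s < t" if "a < t" for a
    using that unfolding eventually_at_left_field by blast
  obtain a where "a \<in> I" "a < t"
    using accumulates[of "t - 1"] by auto
  moreover have "s \<in> I" if "a < s" "s < t" for s
    using accumulates[OF \<open>s < t\<close>] mem_is_interval_1_I[OF assms \<open>a \<in> I\<close>] \<open>a < s\<close> by (meson less_imp_le)
  ultimately show "\<forall>\<^sub>F s in at_left t. s \<in> I"
    unfolding eventually_at_left_field by blast
qed

lemma tendsto_indicator_at_left:
  fixes I :: "real set"
  assumes "is_interval I"
  shows "(indicat_real I \<longlongrightarrow> of_bool (\<forall>\<^sub>F s in at_left t. s \<in> I)) (at_left t)"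
proof (cases "\<forall>\<^sub>F s in at_left t. s \<in> I")
  case True
  then have "\<forall>\<^sub>F s in at_left t. indicat_real I s = 1"
    by (rule eventually_mono) simp
  with True show ?thesis
    by (simp add: tendsto_eventually)
next
  case False
  then have "\<forall>\<^sub>F s in at_left t. indicat_real I s = 0"
    using eventually_at_left_is_interval[OF assms, of t] by (auto elim: eventually_mono)
  with False show ?thesis
    by (simp add: tendsto_eventually)
qed

lemma left_jump_indicator:
  fixes I :: "real set"
  assumes "is_interval I"
  shows "left_jump (indicat_real I) t = of_bool (upper_end I t) - of_bool (lower_end I t)"
proof -
  have "\<not> (\<forall>\<^sub>F s in at_left t. s \<notin> I) \<longleftrightarrow> (\<forall>\<^sub>F s in at_left t. s \<in> I)"
    using eventually_at_left_is_interval[OF assms, of t]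
      eventually_frequently[OF trivial_limit_at_left_real, of "\<lambda>s. s \<in> I" t]
    unfolding frequently_def by blast
  then show ?thesis
    by (auto simp: left_jump_eqI[OF tendsto_indicator_at_left[OF assms]] upper_end_def lower_end_def)
qed

lemma less_upper_end:
  assumes "is_interval I" "upper_end I t" "s \<in> I"
  shows "s < t"
proof (rule ccontr)
  assume "\<not> s < t"
  obtain a where "a \<in> I" "a < t"
    using assms(2) eventually_at_left_imp_ex[of "\<lambda>s. s \<in> I" t "t - 1"] by (auto simp: upper_end_def)
  then have "t \<in> I"
    using mem_is_interval_1_I[OF assms(1) \<open>a \<in> I\<close> \<open>s \<in> I\<close>] \<open>\<not> s < t\<close> by simp
  with assms(2) show False
    by (simp add: upper_end_def)
qed

lemma lower_end_le:
  assumes "is_interval I" "lower_end I t" "s \<in> I"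
  shows "t \<le> s"
proof (rule ccontr)
  assume "\<not> t \<le> s"
  then obtain r where "s < r" "r < t" "r \<notin> I"
    using assms(2) eventually_at_left_imp_ex[of "\<lambda>s. s \<notin> I" t s] by (auto simp: lower_end_def)
  moreover have "t \<in> I"
    using assms(2) by (simp add: lower_end_def)
  ultimately show False
    using mem_is_interval_1_I[OF assms(1) \<open>s \<in> I\<close>, of t r] by simp
qed

lemma Uniq_upper_end:
  assumes "is_interval I"
  shows "\<exists>\<^sub>\<le>\<^sub>1t. upper_end I t"
proof (rule Uniq_I)
  fix s t assume "upper_end I s" "upper_end I t"
  have "\<not> a < b" if "upper_end I a" "upper_end I b" for a b
    using eventually_at_left_imp_ex[of "\<lambda>s. s \<in> I" b a] less_upper_end[OF assms that(1)] that(2)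
    by (fastforce simp: upper_end_def)
  with \<open>upper_end I s\<close> \<open>upper_end I t\<close> show "s = t"
    by (meson linorder_neqE)
qed

lemma Uniq_lower_end:
  assumes "is_interval I"
  shows "\<exists>\<^sub>\<le>\<^sub>1t. lower_end I t"
  using lower_end_le[OF assms] by (meson Uniq_I lower_end_def order_antisym)

lemma finite_Collect_Uniq:
  assumes "\<exists>\<^sub>\<le>\<^sub>1x. Q x"
  shows "finite {x. Q x}"
proof -
  have "\<exists>a. {x. Q x} \<subseteq> {a}"
    using assms by (simp only: subset_singleton_iff_Uniq mem_Collect_eq)
  then show ?thesis
    by (auto intro: finite_subset)
qed

lemma sum_of_bool_Uniq:
  assumes "finite A" "\<exists>\<^sub>\<le>\<^sub>1x. Q x"
  shows "(\<Sum>x\<in>A. of_bool (Q x)) = (of_bool (\<exists>x\<in>A. Q x) :: 'a::semiring_1)"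
proof (cases "\<exists>x\<in>A. Q x")
  case True
  then obtain a where "a \<in> A" "Q a"
    by blast
  with assms(2) have "A \<inter> {x. Q x} = {a}"
    by (auto dest: Uniq_D)
  with True assms(1) show ?thesis
    by simp
qed simp

lemma finite_ends:
  assumes "is_interval I"
  shows "finite {t. upper_end I t \<or> lower_end I t}"
  unfolding Collect_disj_eq
  using finite_Collect_Uniq[OF Uniq_upper_end[OF assms]] finite_Collect_Uniq[OF Uniq_lower_end[OF assms]]
  by simp

lemma left_tame_indicator:
  fixes I :: "real set"
  assumes "is_interval I"
  shows "left_tame (indicat_real I)"
proof -
  have "finite {t. left_jump (indicat_real I) t \<noteq> 0}"
    by (rule finite_subset[OF _ finite_ends[OF assms]]) (auto simp: left_jump_indicator[OF assms])
  then show ?thesis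
    unfolding left_tame_def using tendsto_indicator_at_left[OF assms] by blast
qed

lemma jump_sum_indicator:
  fixes I :: "real set"
  assumes "is_interval I"
  shows "jump_sum (indicat_real I) = of_bool (\<exists>t>0. upper_end I t) - of_bool (\<exists>t>0. lower_end I t)"
proof -
  define A where "A = {t. upper_end I t \<or> lower_end I t} \<inter> {0<..}"
  have "finite A"
    using finite_ends[OF assms] by (simp add: A_def)
  then have "jump_sum (indicat_real I) = sum (left_jump (indicat_real I)) A"
    by (rule jump_sum_eq_sum) (auto simp: A_def left_jump_indicator[OF assms])
  also have "\<dots> = (\<Sum>t\<in>A. of_bool (upper_end I t)) - (\<Sum>t\<in>A. of_bool (lower_end I t))"
    unfolding sum_subtractf[symmetric] by (intro sum.cong refl left_jump_indicator assms)
  also have "\<dots> = of_bool (\<exists>t\<in>A. upper_end I t) - of_bool (\<exists>t\<in>A. lower_end I t)"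
    by (simp only: sum_of_bool_Uniq[OF \<open>finite A\<close>] Uniq_upper_end[OF assms] Uniq_lower_end[OF assms])
  also have "(\<exists>t\<in>A. upper_end I t) \<longleftrightarrow> (\<exists>t>0. upper_end I t)"
    by (auto simp: A_def)
  also have "(\<exists>t\<in>A. lower_end I t) \<longleftrightarrow> (\<exists>t>0. lower_end I t)"
    by (auto simp: A_def)
  finally show ?thesis .
qed

lemma not_upper_end_closed:
  fixes I :: "real set"
  assumes "closed I"
  shows "\<not> upper_end I t"
proof
  assume upper: "upper_end I t"
  then have "\<forall>\<^sub>F s in at_left t. s \<in> - I"
    using assms by (intro eventually_at_left_in_open) (auto simp: upper_end_def)
  with upper have "\<forall>\<^sub>F s in at_left t. s \<in> I \<and> s \<in> - I"
    unfolding upper_end_def by (intro eventually_conj) auto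
  then show False by simp
qed

lemma not_lower_end_open:
  fixes I :: "real set"
  assumes "open I"
  shows "\<not> lower_end I t"
proof
  assume lower: "lower_end I t"
  then have "\<forall>\<^sub>F s in at_left t. s \<in> I"
    using assms by (intro eventually_at_left_in_open) (auto simp: lower_end_def)
  with lower have "\<forall>\<^sub>F s in at_left t. s \<in> I \<and> s \<notin> I"
    unfolding lower_end_def by (intro eventually_conj) auto
  then show False by simp
qed

lemma lower_end_Inf:
  fixes I :: "real set"
  assumes "closed I" "I \<noteq> {}" "bdd_below I"
  shows "lower_end I (Inf I)"
  unfolding lower_end_def
proof
  show "Inf I \<in> I"
    using closed_contains_Inf assms by blast
  have "s \<notin> I" if "s < Inf I" for s
    using cInf_lower[OF _ assms(3), of s] that by auto
  then show "\<forall>\<^sub>F s in at_left (Inf I). s \<notin> I"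
    by (auto simp: eventually_at_filter)
qed

lemma upper_end_Sup:
  fixes I :: "real set"
  assumes "is_interval I" "open I" "I \<noteq> {}" "bdd_above I"
  shows "upper_end I (Sup I)"
  unfolding upper_end_def
proof
  have "\<forall>x\<in>I. x < Sup I + 1"
    using cSup_upper[OF _ assms(4)] by (simp add: add.commute add_strict_increasing)
  then show notin: "Sup I \<notin> I"
    by (rule Sup_notin_open[OF assms(2)])
  obtain s where "s \<in> I"
    using assms(3) by blast
  then have "s < Sup I"
    using cSup_upper[OF _ assms(4)] notin by (metis order_less_le)
  moreover have "y \<in> I" if "s < y" "y < Sup I" for y
  proof -
    obtain z where "z \<in> I" "y < z"
      using less_cSupE[OF \<open>y < Sup I\<close> assms(3)] by blast
    then show ?thesis
      using mem_is_interval_1_I[OF assms(1) \<open>s \<in> I\<close>] \<open>s < y\<close> by (meson less_imp_le)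
  qed
  ultimately show "\<forall>\<^sub>F y in at_left (Sup I). y \<in> I"
    unfolding eventually_at_left_field by blast
qed

lemma jump_sum_indicator_closed:
  assumes "is_interval I" "closed I"
  shows "jump_sum (indicat_real I) = - of_bool (I \<noteq> {} \<and> I \<subseteq> {0<..})"
proof -
  have "(\<exists>t>0. lower_end I t) \<longleftrightarrow> I \<noteq> {} \<and> I \<subseteq> {0<..}"
  proof
    assume "\<exists>t>0. lower_end I t"
    then show "I \<noteq> {} \<and> I \<subseteq> {0<..}"
      using lower_end_le[OF assms(1)] by (fastforce simp: lower_end_def)
  next
    assume positive: "I \<noteq> {} \<and> I \<subseteq> {0<..}"
    then have "bdd_below I"
      by (meson bdd_below.I greaterThan_iff less_imp_le subsetD)
    with positive have "lower_end I (Inf I)"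
      by (intro lower_end_Inf assms(2)) auto
    with positive show "\<exists>t>0. lower_end I t"
      by (auto simp: lower_end_def)
  qed
  then show ?thesis
    by (simp add: jump_sum_indicator[OF assms(1)] not_upper_end_closed[OF assms(2)])
qed

lemma jump_sum_indicator_open:
  assumes "is_interval I" "open I" "bdd_above I"
  shows "jump_sum (indicat_real I) = of_bool (I \<inter> {0<..} \<noteq> {})"
proof -
  have "(\<exists>t>0. upper_end I t) \<longleftrightarrow> I \<inter> {0<..} \<noteq> {}"
  proof
    assume "\<exists>t>0. upper_end I t"
    then show "I \<inter> {0<..} \<noteq> {}"
      using eventually_at_left_imp_ex[of "\<lambda>s. s \<in> I" _ 0] by (fastforce simp: upper_end_def)
  next
    assume "I \<inter> {0<..} \<noteq> {}"
    then obtain s where "s \<in> I" "s > 0"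
      by auto
    then have "upper_end I (Sup I)"
      by (intro upper_end_Sup assms) auto
    moreover have "Sup I > 0"
      using cSup_upper[OF \<open>s \<in> I\<close> assms(3)] \<open>s > 0\<close> by simp
    ultimately show "\<exists>t>0. upper_end I t"
      by blast
  qed
  then show ?thesis
    by (simp add: jump_sum_indicator[OF assms(1)] not_lower_end_open[OF assms(2)])
qed

lemma jump_sum_indicator_subset_singleton:
  assumes "I \<subseteq> {a}"
  shows "jump_sum (indicat_real I) = - of_bool (I \<inter> {0<..} \<noteq> {})"
proof -
  have "I = {} \<or> I = {a}"
    using assms by auto
  then show ?thesis
    using jump_sum_indicator_closed[of I] by (auto simp: is_interval_convex_1)
qed

section \<open>Difference operators and cones\<close>

definition tame_on_lines :: "('a::real_vector \<Rightarrow> real) \<Rightarrow> bool" where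
  "tame_on_lines \<phi> \<longleftrightarrow> (\<forall>x w. left_tame (\<lambda>t. \<phi> (x + t *\<^sub>R w)))"

text \<open>Convolution of \<open>\<phi>\<close> with \<open>b = - [\<real>\<^sub><\<^sub>0 w]\<close>.\<close>

definition line_jump :: "'a::real_vector \<Rightarrow> ('a \<Rightarrow> real) \<Rightarrow> 'a \<Rightarrow> real" where
  "line_jump w \<phi> x = jump_sum (\<lambda>t. \<phi> (x + t *\<^sub>R w))"

primrec iter_diff :: "'a::ab_group_add list \<Rightarrow> ('a \<Rightarrow> real) \<Rightarrow> 'a \<Rightarrow> real" where
  "iter_diff [] \<phi> = \<phi>"
| "iter_diff (w # ws) \<phi> = (\<lambda>x. iter_diff ws \<phi> x - iter_diff ws \<phi> (x - w))"

lemma tame_on_lines_diff: "tame_on_lines \<phi> \<Longrightarrow> tame_on_lines \<theta> \<Longrightarrow> tame_on_lines (\<lambda>x. \<phi> x - \<theta> x)"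
  by (simp add: tame_on_lines_def left_tame_diff)

lemma tame_on_lines_cmult: "tame_on_lines \<phi> \<Longrightarrow> tame_on_lines (\<lambda>x. c * \<phi> x)"
  by (simp add: tame_on_lines_def left_tame_cmult)

lemma tame_on_lines_shift:
  assumes "tame_on_lines \<phi>"
  shows "tame_on_lines (\<lambda>x. \<phi> (x - w))"
  unfolding tame_on_lines_def
proof (intro allI)
  fix x v
  have "left_tame (\<lambda>t. \<phi> ((x - w) + t *\<^sub>R v))"
    using assms unfolding tame_on_lines_def by blast
  then show "left_tame (\<lambda>t. \<phi> (x + t *\<^sub>R v - w))"
    by (simp add: algebra_simps)
qed

lemma tame_on_lines_iter_diff: "tame_on_lines \<phi> \<Longrightarrow> tame_on_lines (iter_diff ws \<phi>)"
  by (induction ws) (simp_all add: tame_on_lines_diff tame_on_lines_shift)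

lemma line_jump_diff:
  assumes "tame_on_lines \<phi>" "tame_on_lines \<theta>"
  shows "line_jump w (\<lambda>x. \<phi> x - \<theta> x) x = line_jump w \<phi> x - line_jump w \<theta> x"
  using assms unfolding line_jump_def tame_on_lines_def by (simp add: jump_sum_diff)

lemma line_jump_cmult:
  assumes "tame_on_lines \<phi>"
  shows "line_jump w (\<lambda>x. c * \<phi> x) x = c * line_jump w \<phi> x"
  using assms unfolding line_jump_def tame_on_lines_def by (simp add: jump_sum_cmult)

lemma line_jump_shift: "line_jump w (\<lambda>x. \<phi> (x - v)) x = line_jump w \<phi> (x - v)"
  unfolding line_jump_def by (simp add: algebra_simps)

lemma line_jump_zero: "line_jump w (\<lambda>_. 0) x = 0"
  unfolding line_jump_def jump_sum_def by (simp add: left_jump_eqI[OF tendsto_const])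

lemma iter_diff_line_jump:
  assumes "tame_on_lines \<phi>"
  shows "iter_diff ws (line_jump w \<phi>) = line_jump w (iter_diff ws \<phi>)"
proof (induction ws)
  case (Cons v ws)
  note tame = tame_on_lines_iter_diff[OF assms, of ws]
  from Cons show ?case
    by (simp add: line_jump_diff[OF tame tame_on_lines_shift[OF tame]] line_jump_shift fun_eq_iff)
qed simp

lemma iter_diff_add: "iter_diff ws (\<lambda>x. \<phi> x + \<theta> x) = (\<lambda>x. iter_diff ws \<phi> x + iter_diff ws \<theta> x)"
  by (induction ws) auto

lemma iter_diff_periodic:
  assumes "\<And>x. \<phi> (x - w) = \<phi> x"
  shows "iter_diff ws \<phi> (x - w) = iter_diff ws \<phi> x"
proof (induction ws arbitrary: x)
  case (Cons v ws)
  from Cons[of x] Cons[of "x - v"] show ?case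
    by (simp add: algebra_simps)
qed (simp add: assms)

subsection \<open>Sums of a convex set and a ray\<close>

definition plus_ray :: "'a::real_vector set \<Rightarrow> 'a \<Rightarrow> 'a set" where
  "plus_ray C w = {x + t *\<^sub>R w | x t. x \<in> C \<and> t \<ge> 0}"

lemma convex_cone_hull_insert: "convex_cone hull (insert w S) = plus_ray (convex_cone hull S) w"
proof -
  have "convex_cone hull {w} = {t *\<^sub>R w | t. t \<ge> 0}"
    by (auto simp: convex_cone_hull_convex_hull_nonempty)
  then have "convex_cone hull (S \<union> {w}) = plus_ray (convex_cone hull S) w"
    unfolding convex_cone_hull_Un plus_ray_def by auto
  then show ?thesis
    by simp
qed

lemma mem_plus_ray_iff: "x \<in> plus_ray C w \<longleftrightarrow> (\<exists>t\<le>0. x + t *\<^sub>R w \<in> C)"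
proof
  assume "x \<in> plus_ray C w"
  then obtain y t where "x = y + t *\<^sub>R w" "y \<in> C" "t \<ge> 0"
    by (auto simp: plus_ray_def)
  then show "\<exists>t\<le>0. x + t *\<^sub>R w \<in> C"
    by (intro exI[of _ "- t"]) simp
next
  assume "\<exists>t\<le>0. x + t *\<^sub>R w \<in> C"
  then obtain t where "t \<le> 0" "x + t *\<^sub>R w \<in> C"
    by blast
  then show "x \<in> plus_ray C w"
    unfolding plus_ray_def by (intro CollectI exI[of _ "x + t *\<^sub>R w"] exI[of _ "- t"]) simp
qed

lemma rel_interior_plus_ray:
  fixes C :: "'a::euclidean_space set"
  assumes "convex C"
  shows "rel_interior (plus_ray C w) = {x + t *\<^sub>R w | x t. x \<in> rel_interior C \<and> t > 0}"
proof -
  define f :: "'a \<times> real \<Rightarrow> 'a" where "f = (\<lambda>(x, t). x + t *\<^sub>R w)"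
  have "linear f"
    by (auto simp: f_def linear_iff algebra_simps)
  have "plus_ray C w = f ` (C \<times> {0..})"
    by (auto simp: plus_ray_def f_def image_iff)
  then have "rel_interior (plus_ray C w) = f ` rel_interior (C \<times> {0..})"
    using rel_interior_convex_linear_image[OF \<open>linear f\<close>] assms
    by (metis convex_Times convex_real_interval(1))
  also have "\<dots> = f ` (rel_interior C \<times> {0<..})"
    using assms by (simp add: rel_interior_Times)
  also have "\<dots> = {x + t *\<^sub>R w | x t. x \<in> rel_interior C \<and> t > 0}"
    by (auto simp: f_def image_iff)
  finally show ?thesis .
qed

lemma mem_rel_interior_plus_ray_iff:
  fixes C :: "'a::euclidean_space set"
  assumes "convex C"
  shows "x \<in> rel_interior (plus_ray C w) \<longleftrightarrow> (\<exists>t>0. x - t *\<^sub>R w \<in> rel_interior C)"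
proof
  assume "x \<in> rel_interior (plus_ray C w)"
  then show "\<exists>t>0. x - t *\<^sub>R w \<in> rel_interior C"
    by (auto simp: rel_interior_plus_ray[OF assms])
next
  assume "\<exists>t>0. x - t *\<^sub>R w \<in> rel_interior C"
  then obtain t where "t > 0" "x - t *\<^sub>R w \<in> rel_interior C"
    by blast
  moreover have "x = (x - t *\<^sub>R w) + t *\<^sub>R w"
    by simp
  ultimately show "x \<in> rel_interior (plus_ray C w)"
    unfolding rel_interior_plus_ray[OF assms] by blast
qed

lemma dim_plus_ray:
  fixes C :: "'a::euclidean_space set"
  assumes "0 \<in> C"
  shows "dim (plus_ray C w) = (if w \<in> span C then dim C else Suc (dim C))"
proof -
  have "w \<in> plus_ray C w"
    using assms by (auto simp: mem_plus_ray_iff intro!: exI[of _ "- 1"])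
  moreover have "C \<subseteq> plus_ray C w"
    by (auto simp: mem_plus_ray_iff intro!: exI[of _ 0])
  moreover have "plus_ray C w \<subseteq> span (insert w C)"
    by (auto simp: plus_ray_def intro!: span_add span_scale intro: span_base)
  ultimately have "span (plus_ray C w) = span (insert w C)"
    by (meson insert_subsetI span_mono span_minimal subspace_span subset_antisym)
  then have "dim (plus_ray C w) = dim (insert w C)"
    by (metis dim_span)
  then show ?thesis
    by (simp add: dim_insert)
qed

subsection \<open>Line slices\<close>

lemma is_interval_line_slice:
  assumes "convex K"
  shows "is_interval {t. x + t *\<^sub>R w \<in> K}"
proof -
  have "{t. x + t *\<^sub>R w \<in> K} = (\<lambda>t. t *\<^sub>R w) -` ((+) (- x) ` K)"
    by (force simp: image_iff algebra_simps)
  moreover have "linear (\<lambda>t. t *\<^sub>R w)"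
    by (rule linear_scaleR_left)
  ultimately show ?thesis
    using assms by (simp add: is_interval_convex_1 convex_linear_vimage convex_translation)
qed

lemma closed_line_slice:
  fixes K :: "'a::real_normed_vector set"
  assumes "closed K"
  shows "closed {t. x + t *\<^sub>R w \<in> K}"
proof -
  have "closed ((\<lambda>t. x + t *\<^sub>R w) -` K)"
    by (intro closed_vimage assms continuous_intros)
  then show ?thesis
    by (simp add: vimage_def)
qed

lemma line_slice_subset_singleton:
  assumes "w \<notin> span K"
  shows "\<exists>a. {t. x + t *\<^sub>R w \<in> K} \<subseteq> {a}"
proof -
  have "s = t" if "x + s *\<^sub>R w \<in> K" "x + t *\<^sub>R w \<in> K" for s t
  proof (rule ccontr)
    assume "s \<noteq> t"
    have "(x + s *\<^sub>R w) - (x + t *\<^sub>R w) \<in> span K"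
      using that by (intro span_diff span_base)
    then have "(s - t) *\<^sub>R w \<in> span K"
      by (simp add: algebra_simps)
    then have "w \<in> span K"
      using \<open>s \<noteq> t\<close> span_scale[of "(s - t) *\<^sub>R w" K "1 / (s - t)"] by simp
    with assms show False by blast
  qed
  then show ?thesis by blast
qed

lemma open_line_slice_rel_interior:
  fixes C :: "'a::euclidean_space set"
  assumes "0 \<in> C" "w \<in> span C"
  shows "open {t. x + t *\<^sub>R w \<in> rel_interior C}"
proof (cases "x \<in> span C")
  case True
  have "affine hull C = span C"
    using assms(1) by (simp add: affine_hull_span_0 hull_inc)
  then have "openin (top_of_set (span C)) (rel_interior C)"
    using openin_rel_interior[of C] by simp
  moreover have "(\<lambda>t. x + t *\<^sub>R w) \<in> UNIV \<rightarrow> span C"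
    using True assms(2) by (auto intro: span_add span_scale)
  ultimately have "openin (top_of_set UNIV) (UNIV \<inter> (\<lambda>t. x + t *\<^sub>R w) -` rel_interior C)"
    by (intro continuous_openin_preimage[where T = "span C"] continuous_intros)
  then show ?thesis
    by (simp add: vimage_def)
next
  case False
  have "x + t *\<^sub>R w \<notin> rel_interior C" for t
  proof
    assume "x + t *\<^sub>R w \<in> rel_interior C"
    then have "(x + t *\<^sub>R w) - t *\<^sub>R w \<in> span C"
      using rel_interior_subset[of C] assms(2) by (intro span_diff span_scale) (auto intro: span_base)
    with False show False by simp
  qed
  then show ?thesis by simp
qed

lemma bdd_above_line_slice:
  assumes "K \<subseteq> {y. a \<bullet> y \<ge> 0}" "a \<bullet> w < 0"
  shows "bdd_above {t. x + t *\<^sub>R w \<in> K}"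
proof (rule bdd_aboveI)
  fix t assume "t \<in> {t. x + t *\<^sub>R w \<in> K}"
  then have "t * - (a \<bullet> w) \<le> a \<bullet> x"
    using assms(1) by (auto simp: inner_simps)
  then show "t \<le> (a \<bullet> x) / - (a \<bullet> w)"
    using assms(2) by (simp only: pos_le_divide_eq neg_0_less_iff_less)
qed

lemma indicator_line_slice:
  "(\<lambda>t. indicat_real K (x + t *\<^sub>R w)) = indicat_real {t. x + t *\<^sub>R w \<in> K}"
  by (auto simp: indicator_def)

lemma line_jump_indicator: "line_jump w (indicat_real K) x = jump_sum (indicat_real {t. x + t *\<^sub>R w \<in> K})"
  by (simp add: line_jump_def indicator_line_slice)

lemma tame_on_lines_indicator: "convex K \<Longrightarrow> tame_on_lines (indicat_real K)"
  by (simp add: tame_on_lines_def indicator_line_slice left_tame_indicator is_interval_line_slice)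

subsection \<open>Reciprocity for indicators of cones\<close>

lemma indicator_plus_ray:
  fixes C :: "'a::real_normed_vector set"
  assumes "convex C" "closed C"
  shows "indicat_real (plus_ray C w) x =
    indicat_real {x. \<exists>t. x + t *\<^sub>R w \<in> C} x + line_jump w (indicat_real C) x"
proof -
  define I where "I = {t. x + t *\<^sub>R w \<in> C}"
  have "line_jump w (indicat_real C) x = - of_bool (I \<noteq> {} \<and> I \<subseteq> {0<..})"
    unfolding line_jump_indicator I_def
    by (intro jump_sum_indicator_closed is_interval_line_slice closed_line_slice assms)
  moreover have "x \<in> plus_ray C w \<longleftrightarrow> \<not> I \<subseteq> {0<..}"
    by (auto simp: mem_plus_ray_iff I_def subset_iff not_less)
  moreover have "(\<exists>t. x + t *\<^sub>R w \<in> C) \<longleftrightarrow> I \<noteq> {}"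
    by (auto simp: I_def)
  ultimately show ?thesis
    by (auto simp: indicator_def)
qed

definition reflected_interior :: "'a::euclidean_space set \<Rightarrow> 'a \<Rightarrow> real" where
  "reflected_interior C x = (- 1) ^ dim C * indicat_real {y. - y \<in> rel_interior C} x"

lemma convex_reflected_rel_interior:
  fixes C :: "'a::euclidean_space set"
  assumes "convex C"
  shows "convex {y. - y \<in> rel_interior C}"
  using convex_linear_vimage[OF linear_uminus convex_rel_interior[OF assms]] by (simp add: vimage_def)

lemma tame_on_lines_reflected_interior: "convex C \<Longrightarrow> tame_on_lines (reflected_interior C)"
  unfolding reflected_interior_def[abs_def]
  by (intro tame_on_lines_cmult tame_on_lines_indicator convex_reflected_rel_interior)

lemma line_jump_reflected_rel_interior:
  fixes C :: "'a::euclidean_space set"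
  assumes "convex C" "0 \<in> C" and "a \<bullet> w > 0" "C \<subseteq> {y. a \<bullet> y \<ge> 0}"
  shows "line_jump w (indicat_real {y. - y \<in> rel_interior C}) x =
    (if w \<in> span C then 1 else - 1) * indicat_real {y. - y \<in> rel_interior (plus_ray C w)} x"
proof -
  define I where "I = {t. - x + t *\<^sub>R (- w) \<in> rel_interior C}"
  have slice: "{t. x + t *\<^sub>R w \<in> {y. - y \<in> rel_interior C}} = I"
    by (simp add: I_def)
  have interval: "is_interval I"
    unfolding slice[symmetric] by (intro is_interval_line_slice convex_reflected_rel_interior assms)
  have "jump_sum (indicat_real I) = (if w \<in> span C then 1 else - 1) * of_bool (I \<inter> {0<..} \<noteq> {})"
  proof (cases "w \<in> span C")
    case True
    have "rel_interior C \<subseteq> {y. a \<bullet> y \<ge> 0}"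
      using rel_interior_subset assms(4) by (rule order_trans)
    then have "bdd_above I"
      unfolding I_def using assms(3) by (intro bdd_above_line_slice) auto
    moreover have "open I"
      unfolding I_def using True by (intro open_line_slice_rel_interior assms span_neg)
    ultimately show ?thesis
      using True by (simp add: jump_sum_indicator_open[OF interval])
  next
    case False
    then have "- w \<notin> span (rel_interior C)"
      using span_mono[OF rel_interior_subset[of C]] span_neg[of "- w"] by auto
    then obtain b where "I \<subseteq> {b}"
      unfolding I_def using line_slice_subset_singleton by blast
    with False show ?thesis
      by (simp add: jump_sum_indicator_subset_singleton)
  qed
  moreover have "- x \<in> rel_interior (plus_ray C w) \<longleftrightarrow> I \<inter> {0<..} \<noteq> {}"
    by (auto simp: mem_rel_interior_plus_ray_iff[OF assms(1)] I_def)
  ultimately show ?thesis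
    unfolding line_jump_indicator slice by (simp add: indicator_def)
qed

lemma line_jump_reflected_interior:
  fixes C :: "'a::euclidean_space set"
  assumes "convex C" "0 \<in> C" and "a \<bullet> w > 0" "C \<subseteq> {y. a \<bullet> y \<ge> 0}"
  shows "line_jump w (reflected_interior C) x = reflected_interior (plus_ray C w) x"
proof -
  have "line_jump w (reflected_interior C) x =
      (- 1) ^ dim C * line_jump w (indicat_real {y. - y \<in> rel_interior C}) x"
    unfolding reflected_interior_def[abs_def]
    by (intro line_jump_cmult tame_on_lines_indicator convex_reflected_rel_interior assms)
  also have "\<dots> = reflected_interior (plus_ray C w) x"
    unfolding line_jump_reflected_rel_interior[OF assms] reflected_interior_def
    by (simp add: dim_plus_ray[OF assms(2)])
  finally show ?thesis .
qed

definition reciprocity_defect :: "'a::euclidean_space set \<Rightarrow> 'a \<Rightarrow> real" where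
  "reciprocity_defect C x = indicat_real C x - reflected_interior C x"

lemma tame_on_lines_reciprocity_defect: "convex C \<Longrightarrow> tame_on_lines (reciprocity_defect C)"
  unfolding reciprocity_defect_def[abs_def]
  by (intro tame_on_lines_diff tame_on_lines_indicator tame_on_lines_reflected_interior)

lemma reciprocity_defect_plus_ray:
  fixes C :: "'a::euclidean_space set"
  assumes "convex C" "closed C" "0 \<in> C" and "a \<bullet> w > 0" "C \<subseteq> {y. a \<bullet> y \<ge> 0}"
  shows "reciprocity_defect (plus_ray C w) x =
    indicat_real {x. \<exists>t. x + t *\<^sub>R w \<in> C} x + line_jump w (reciprocity_defect C) x"
proof -
  have "line_jump w (reciprocity_defect C) x =
      line_jump w (indicat_real C) x - line_jump w (reflected_interior C) x"
    unfolding reciprocity_defect_def[abs_def]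
    by (intro line_jump_diff tame_on_lines_indicator tame_on_lines_reflected_interior assms)
  moreover have "line_jump w (reflected_interior C) x = reflected_interior (plus_ray C w) x"
    using assms by (intro line_jump_reflected_interior)
  ultimately show ?thesis
    by (simp add: reciprocity_defect_def[of "plus_ray C w"] indicator_plus_ray[OF assms(1,2)])
qed

lemma indicator_cylinder_shift:
  fixes C :: "'a::real_vector set"
  shows "indicat_real {x. \<exists>t. x + t *\<^sub>R w \<in> C} (x - w) = indicat_real {x. \<exists>t. x + t *\<^sub>R w \<in> C} x"
proof -
  have "(\<exists>t. x - w + t *\<^sub>R w \<in> C) \<longleftrightarrow> (\<exists>t. x + t *\<^sub>R w \<in> C)"
  proof (intro iffI; elim exE)
    fix t assume "x - w + t *\<^sub>R w \<in> C"
    then have "x + (t - 1) *\<^sub>R w \<in> C"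
      by (simp add: algebra_simps)
    then show "\<exists>t. x + t *\<^sub>R w \<in> C" ..
  next
    fix t assume "x + t *\<^sub>R w \<in> C"
    then have "x - w + (t + 1) *\<^sub>R w \<in> C"
      by (simp add: algebra_simps)
    then show "\<exists>t. x - w + t *\<^sub>R w \<in> C" ..
  qed
  then show ?thesis
    by (simp add: indicator_def)
qed

proposition iter_diff_reciprocity_defect:
  fixes ws :: "'a::euclidean_space list"
  assumes "\<And>w. w \<in> set ws \<Longrightarrow> a \<bullet> w > 0"
  shows "iter_diff ws (reciprocity_defect (convex_cone hull (set ws))) = (\<lambda>_. 0)"
  using assms
proof (induction ws)
  case Nil
  show ?case
    by (auto simp: reciprocity_defect_def reflected_interior_def indicator_def)
next
  case (Cons w ws)
  define C where "C = convex_cone hull (set ws)"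
  have C: "convex C" "closed C" "0 \<in> C"
    by (simp_all add: C_def convex_convex_cone_hull closed_convex_cone_hull convex_cone_hull_contains_0)
  have nonneg: "C \<subseteq> {y. a \<bullet> y \<ge> 0}"
    unfolding C_def using Cons.prems
    by (intro hull_minimal convex_cone_halfspace_ge) (auto intro: less_imp_le)
  have "a \<bullet> w > 0"
    using Cons.prems by simp
  define \<theta> where "\<theta> = indicat_real {x. \<exists>t. x + t *\<^sub>R w \<in> C}"
  have "reciprocity_defect (plus_ray C w) = (\<lambda>x. \<theta> x + line_jump w (reciprocity_defect C) x)"
    unfolding \<theta>_def by (rule ext) (rule reciprocity_defect_plus_ray[OF C \<open>a \<bullet> w > 0\<close> nonneg])
  then have "iter_diff ws (reciprocity_defect (plus_ray C w)) =
      (\<lambda>x. iter_diff ws \<theta> x + line_jump w (iter_diff ws (reciprocity_defect C)) x)"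
    by (simp add: iter_diff_add iter_diff_line_jump tame_on_lines_reciprocity_defect C(1))
  also have "\<dots> = iter_diff ws \<theta>"
    using Cons by (simp add: C_def line_jump_zero)
  finally have "iter_diff (w # ws) (reciprocity_defect (plus_ray C w)) =
      (\<lambda>x. iter_diff ws \<theta> x - iter_diff ws \<theta> (x - w))"
    by simp
  also have "\<dots> = (\<lambda>_. 0)"
    by (simp add: iter_diff_periodic \<theta>_def indicator_cylinder_shift)
  finally show ?case
    by (simp only: list.set convex_cone_hull_insert C_def)
qed

section \<open>Finite differences and quasi-polynomials\<close>

definition back_diff :: "int \<Rightarrow> (int \<Rightarrow> 'a::ab_group_add) \<Rightarrow> int \<Rightarrow> 'a" where
  "back_diff m f d = f d - f (d - m)"

lemma back_diff_funpow_diff: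
  "(back_diff m ^^ k) (\<lambda>d. f d - g d) = (\<lambda>d. (back_diff m ^^ k) f d - (back_diff m ^^ k) g d)"
  by (induction k) (auto simp: fun_eq_iff back_diff_def)

lemma back_diff_funpow_reflect:
  "(back_diff m ^^ k) (\<lambda>d. f (- d)) = (\<lambda>d. (back_diff (- m) ^^ k) f (- d))"
  by (induction k) (auto simp: fun_eq_iff back_diff_def)

lemma back_diff_funpow_progression:
  "(back_diff 1 ^^ k) (\<lambda>i. f (d + i * m)) = (\<lambda>i. (back_diff m ^^ k) f (d + i * m))"
  by (induction k) (auto simp: fun_eq_iff back_diff_def algebra_simps)

lemma pochhammer_Suc_diff:
  fixes x :: "'a::comm_ring_1"
  shows "pochhammer x (Suc n) - pochhammer (x - 1) (Suc n) = of_nat (Suc n) * pochhammer x n"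
  using pochhammer_rec[of "x - 1" n] by (simp add: pochhammer_rec' algebra_simps)

lemma back_diff_1_eq_0_imp_const:
  assumes "back_diff 1 f = (\<lambda>_. 0)"
  shows "f i = f 0"
proof -
  have shift: "f i = f (i - 1)" for i
    using fun_cong[OF assms, of i] by (simp add: back_diff_def)
  show ?thesis
  proof (induction i rule: int_induct[of _ 0])
    case (step1 i)
    then show ?case using shift[of "i + 1"] by simp
  next
    case (step2 i)
    then show ?case using shift[of i] by simp
  qed simp
qed

lemma back_diff_1_funpow_eq_0_imp_sum_pochhammer:
  fixes f :: "int \<Rightarrow> 'a::field_char_0"
  assumes "(back_diff 1 ^^ n) f = (\<lambda>_. 0)"
  shows "\<exists>c. \<forall>i. f i = (\<Sum>k<n. c k * pochhammer (of_int i) k)"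
  using assms
proof (induction n arbitrary: f)
  case 0
  then show ?case by simp
next
  case (Suc n)
  then have "(back_diff 1 ^^ n) (back_diff 1 f) = (\<lambda>_. 0)"
    by (simp add: funpow_swap1)
  with Suc.IH obtain c where diff_f: "\<And>i. back_diff 1 f i = (\<Sum>k<n. c k * pochhammer (of_int i) k)"
    by blast
  define s where "s i = (\<Sum>k<n. c k / of_nat (Suc k) * pochhammer (of_int i) (Suc k))" for i
  have "back_diff 1 s i = (\<Sum>k<n. c k / of_nat (Suc k) *
      (pochhammer (of_int i) (Suc k) - pochhammer (of_int i - 1) (Suc k)))" for i
    by (simp add: back_diff_def s_def sum_subtractf right_diff_distrib)
  then have "back_diff 1 s i = back_diff 1 f i" for i
    by (simp add: pochhammer_Suc_diff diff_f del: of_nat_Suc)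
  then have "back_diff 1 (\<lambda>i. f i - s i) = (\<lambda>_. 0)"
    using back_diff_funpow_diff[of 1 1 f s] by (simp add: fun_eq_iff)
  from back_diff_1_eq_0_imp_const[OF this] have "f i = f 0 - s 0 + s i" for i
    by (simp add: algebra_simps)
  also have "f 0 - s 0 + s i = (\<Sum>k<Suc n. (case k of 0 \<Rightarrow> f 0 - s 0 | Suc k \<Rightarrow> c k / of_nat (Suc k)) *
      pochhammer (of_int i) k)" for i
    by (simp add: s_def sum.lessThan_Suc_shift del: sum.lessThan_Suc of_nat_Suc pochhammer_Suc)
  finally show ?case
    by blast
qed

lemma poly_pochhammer: "poly (pochhammer p n) x = pochhammer (poly p x) n"
  by (induction n) (simp_all add: pochhammer_Suc)

lemma back_diff_1_funpow_eq_0_imp_poly: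
  fixes f :: "int \<Rightarrow> 'a::field_char_0"
  assumes "(back_diff 1 ^^ n) f = (\<lambda>_. 0)"
  shows "\<exists>p. \<forall>i. f i = poly p (of_int i)"
proof -
  obtain c where "\<And>i. f i = (\<Sum>k<n. c k * pochhammer (of_int i) k)"
    using back_diff_1_funpow_eq_0_imp_sum_pochhammer[OF assms] by blast
  then have "f i = poly (\<Sum>k<n. smult (c k) (pochhammer [:0, 1:] k)) (of_int i)" for i
    by (simp add: poly_sum poly_pochhammer)
  then show ?thesis by blast
qed

lemma quasi_polynomial_iff_progressions:
  "quasi_polynomial f \<longleftrightarrow> (\<exists>N::nat. N \<ge> 1 \<and> (\<forall>d. \<exists>p. \<forall>i. f (d + i * int N) = poly p (of_int i)))"
proof
  assume "quasi_polynomial f"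
  then obtain N Q where "N \<ge> 1"
      and f_eq: "\<And>j m. j < N \<Longrightarrow> [m = int j] (mod int N) \<Longrightarrow> f m = poly (Q j) (of_int m)"
    unfolding quasi_polynomial_def by blast
  have "f (d + i * int N) = poly (pcompose (Q (nat (d mod int N))) [:of_int d, of_nat N:]) (of_int i)" for d i
    using f_eq[of "nat (d mod int N)" "d + i * int N"] \<open>N \<ge> 1\<close>
    by (simp add: cong_def poly_pcompose algebra_simps nat_less_iff)
  with \<open>N \<ge> 1\<close> show "\<exists>N::nat. N \<ge> 1 \<and> (\<forall>d. \<exists>p. \<forall>i. f (d + i * int N) = poly p (of_int i))"
    by blast
next
  assume "\<exists>N::nat. N \<ge> 1 \<and> (\<forall>d. \<exists>p. \<forall>i. f (d + i * int N) = poly p (of_int i))"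
  then obtain N :: nat and p where "N \<ge> 1" and f_eq: "\<And>d i. f (d + i * int N) = poly (p d) (of_int i)"
    by metis
  define Q where "Q j = pcompose (p (int j)) [:- of_nat j / of_nat N, 1 / of_nat N:]" for j
  have "f m = poly (Q j) (of_int m)" if cong: "[m = int j] (mod int N)" for j m
  proof -
    obtain i where m_eq: "m = int j + i * int N"
      using cong_sym[OF cong] by (auto simp: cong_iff_lin mult.commute)
    then have "(of_int m :: complex) = of_nat j + of_int i * of_nat N"
      by simp
    then have "poly [:- of_nat j / of_nat N, 1 / of_nat N:] (of_int m :: complex) = of_int i"
      using \<open>N \<ge> 1\<close> by (simp add: add_divide_distrib)
    then show ?thesis
      unfolding Q_def poly_pcompose using f_eq[of "int j" i] m_eq by (simp only:)
  qed
  with \<open>N \<ge> 1\<close> show "quasi_polynomial f"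
    unfolding quasi_polynomial_def by blast
qed

lemma quasi_polynomial_if_back_diff_funpow_eq_0:
  assumes "m \<ge> 1" "(back_diff (int m) ^^ k) f = (\<lambda>_. 0)"
  shows "quasi_polynomial f"
  unfolding quasi_polynomial_iff_progressions
proof (intro exI[of _ m] conjI allI)
  show "\<exists>p. \<forall>i. f (d + i * int m) = poly p (of_int i)" for d
    by (rule back_diff_1_funpow_eq_0_imp_poly[of k]) (simp add: back_diff_funpow_progression assms(2))
qed (rule assms(1))

lemma quasi_polynomial_reflect:
  assumes "quasi_polynomial f"
  shows "quasi_polynomial (\<lambda>d. f (- d))"
proof -
  obtain N :: nat and p where "N \<ge> 1" and f_eq: "\<And>d i. f (d + i * int N) = poly (p d) (of_int i)"
    using assms unfolding quasi_polynomial_iff_progressions by metis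
  moreover have "f (- (d + i * int N)) = poly (pcompose (p (- d)) [:0, - 1:]) (of_int i)" for d i
    using f_eq[of "- d" "- i"] by (simp add: poly_pcompose)
  ultimately show ?thesis
    unfolding quasi_polynomial_iff_progressions by blast
qed

lemma quasi_polynomial_cmult:
  assumes "quasi_polynomial f"
  shows "quasi_polynomial (\<lambda>d. c * f d)"
proof -
  obtain N :: nat and p where "N \<ge> 1" "\<And>d i. f (d + i * int N) = poly (p d) (of_int i)"
    using assms unfolding quasi_polynomial_iff_progressions by metis
  moreover from this have "c * f (d + i * int N) = poly (smult c (p d)) (of_int i)" for d i
    by simp
  ultimately show ?thesis
    unfolding quasi_polynomial_iff_progressions by blast
qed

lemma quasi_polynomial_diff:
  assumes "quasi_polynomial f" "quasi_polynomial g"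
  shows "quasi_polynomial (\<lambda>d. f d - g d)"
proof -
  obtain N :: nat and p where "N \<ge> 1" and f_eq: "\<And>d i. f (d + i * int N) = poly (p d) (of_int i)"
    using assms(1) unfolding quasi_polynomial_iff_progressions by metis
  obtain N' :: nat and q where "N' \<ge> 1" and g_eq: "\<And>d i. g (d + i * int N') = poly (q d) (of_int i)"
    using assms(2) unfolding quasi_polynomial_iff_progressions by metis
  have "f (d + i * int (N * N')) - g (d + i * int (N * N')) =
      poly (pcompose (p d) [:0, of_nat N':] - pcompose (q d) [:0, of_nat N:]) (of_int i)" for d i
    using f_eq[of d "i * int N'"] g_eq[of d "i * int N"] by (simp add: poly_pcompose mult_ac)
  moreover have "N * N' \<ge> 1"
    using \<open>N \<ge> 1\<close> \<open>N' \<ge> 1\<close> by simp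
  ultimately show ?thesis
    unfolding quasi_polynomial_iff_progressions by blast
qed

lemma quasi_polynomial_eventually_0_imp_0:
  assumes "quasi_polynomial f" and "\<forall>\<^sub>F d in at_top. f d = 0"
  shows "f d = 0"
proof -
  obtain N :: nat and p where "N \<ge> 1" and f_eq: "\<And>d i. f (d + i * int N) = poly (p d) (of_int i)"
    using assms(1) unfolding quasi_polynomial_iff_progressions by metis
  have "filterlim (\<lambda>n. d + int n * int N) at_top sequentially"
    unfolding filterlim_at_top
  proof
    fix Z
    have "Z \<le> d + int n * int N" if "n \<ge> nat (Z - d)" for n
    proof -
      have "int n * 1 \<le> int n * int N"
        using \<open>N \<ge> 1\<close> by (intro mult_left_mono) auto
      with that show ?thesis by linarith
    qed
    then show "\<forall>\<^sub>F n in sequentially. Z \<le> d + int n * int N"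
      unfolding eventually_sequentially by blast
  qed
  from eventually_compose_filterlim[OF assms(2) this]
  have "\<forall>\<^sub>F n in sequentially. poly (p d) (of_nat n) = 0"
    by (simp add: f_eq)
  then obtain K where "\<And>n. n \<ge> K \<Longrightarrow> poly (p d) (of_nat n) = 0"
    unfolding eventually_sequentially by blast
  then have "of_nat ` {K..} \<subseteq> {x. poly (p d) x = 0}"
    by auto
  moreover have "infinite (of_nat ` {K..} :: complex set)"
    by (subst finite_image_iff) (auto simp: inj_on_def infinite_Ici)
  ultimately have "p d = 0"
    using poly_roots_finite finite_subset by blast
  then show ?thesis
    using f_eq[of d 0] by simp
qed

lemma quasi_polynomial_eq_if_eventually_eq:
  assumes "quasi_polynomial f" "quasi_polynomial g" and "\<forall>\<^sub>F d in at_top. f d = g d"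
  shows "f = g"
proof
  fix d
  have "f d - g d = 0"
    using assms(3) by (intro quasi_polynomial_eventually_0_imp_0 quasi_polynomial_diff assms) simp
  then show "f d = g d" by simp
qed

section \<open>Rational generating functions\<close>

locale idom_embedding =
  fixes h :: "'a::idom \<Rightarrow> 'b::field"
  assumes hom_add: "h (x + y) = h x + h y"
    and hom_mult: "h (x * y) = h x * h y"
    and hom_1: "h 1 = 1"
    and hom_nonzero: "x \<noteq> 0 \<Longrightarrow> h x \<noteq> 0"
begin

lemma hom_0: "h 0 = 0"
  using hom_add[of 0 0] by (metis add_0 add_cancel_right_right)

lemma hom_minus: "h (- x) = - h x"
  using hom_add[of x "- x"] by (simp add: hom_0 eq_neg_iff_add_eq_0 add.commute)

lemma hom_diff: "h (x - y) = h x - h y"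
  using hom_add[of x "- y"] by (simp add: hom_minus)

lemma hom_power: "h (x ^ n) = h x ^ n"
  by (induction n) (simp_all add: hom_1 hom_mult)

lemma hom_sum: "h (sum f A) = (\<Sum>x\<in>A. h (f x))"
  by (induction A rule: infinite_finite_induct) (simp_all add: hom_0 hom_add)

lemmas hom_ring_simps = hom_1 hom_mult hom_minus hom_diff hom_power hom_sum

lemma degree_map_poly_hom: "degree (map_poly h p) = degree p"
  by (cases "p = 0") (simp_all add: map_poly_degree_eq hom_nonzero)

lemma map_poly_hom_add: "map_poly h (p + q) = map_poly h p + map_poly h q"
  by (simp add: poly_eq_iff coeff_map_poly hom_0 hom_add)

lemma map_poly_hom_smult: "map_poly h (smult c p) = smult (h c) (map_poly h p)"
  by (simp add: poly_eq_iff coeff_map_poly hom_0 hom_mult)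

lemma map_poly_hom_mult: "map_poly h (p * q) = map_poly h p * map_poly h q"
  by (induction p) (simp_all add: map_poly_pCons hom_0 map_poly_hom_add map_poly_hom_smult)

lemma reflect_poly_map_poly_hom: "reflect_poly (map_poly h p) = map_poly h (reflect_poly p)"
  by (simp add: poly_eq_iff coeff_reflect_poly coeff_map_poly hom_0 degree_map_poly_hom)

end

locale field_embedding = idom_embedding h
  for h :: "'a::field \<Rightarrow> 'b::field"
begin

lemma hom_inverse: "h (inverse x) = inverse (h x)"
proof (cases "x = 0")
  case False
  then have "h x * h (inverse x) = 1"
    by (simp flip: hom_mult hom_1)
  then show ?thesis
    by (rule inverse_unique[symmetric])
qed (simp add: hom_0)

lemma hom_divide: "h (x / y) = h x / h y"
  by (simp add: divide_inverse hom_mult hom_inverse)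

lemma hom_power_int: "h (x powi n) = h x powi n"
  by (simp add: power_int_def hom_power hom_inverse)

lemmas hom_field_simps = hom_ring_simps hom_divide hom_power_int

end

subsection \<open>Extension of embeddings to the field of fractions\<close>

definition fract_lift ::
    "('a::{ring_gcd,semiring_gcd_mult_normalize,idom_divide} \<Rightarrow> 'b::field) \<Rightarrow> 'a fract \<Rightarrow> 'b" where
  "fract_lift h R = (case quot_of_fract R of (p, q) \<Rightarrow> h p / h q)"

lemma fract_lift_Fract:
  assumes "idom_embedding h" "q \<noteq> 0"
  shows "fract_lift h (Fract p q) = h p / h q"
proof -
  interpret idom_embedding h by fact
  obtain a b where quot: "quot_of_fract (Fract p q) = (a, b)"
    by (cases "quot_of_fract (Fract p q)")
  have "b \<noteq> 0"
    using snd_quot_of_fract_nonzero[of "Fract p q"] quot by simp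
  have "Fract a b = Fract p q"
    using Fract_quot_of_fract[of "Fract p q"] quot by simp
  then have "a * q = p * b"
    using \<open>b \<noteq> 0\<close> assms(2) by (simp add: eq_fract)
  then have "h a * h q = h p * h b"
    by (simp flip: hom_mult)
  then show ?thesis
    using \<open>b \<noteq> 0\<close> assms(2) by (simp add: fract_lift_def quot frac_eq_eq hom_nonzero)
qed

lemma fract_lift_to_fract:
  assumes "idom_embedding h"
  shows "fract_lift h (to_fract p) = h p"
  using fract_lift_Fract[OF assms, of 1 p] idom_embedding.hom_1[OF assms] by (simp add: to_fract_def)

lemma field_embedding_fract_lift:
  assumes "idom_embedding h"
  shows "field_embedding (fract_lift h)"
proof
  interpret idom_embedding h by fact
  note lift = fract_lift_Fract[OF assms]
  show "fract_lift h (R + S) = fract_lift h R + fract_lift h S" for R S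
    by (cases R; cases S) (simp add: lift hom_add hom_mult hom_nonzero add_frac_eq)
  show "fract_lift h (R * S) = fract_lift h R * fract_lift h S" for R S
    by (cases R; cases S) (simp add: lift hom_mult)
  show "fract_lift h 1 = 1"
    by (simp add: One_fract_def lift hom_1)
  show "fract_lift h R \<noteq> 0" if "R \<noteq> 0" for R
    using that by (cases R) (auto simp: lift hom_nonzero Zero_fract_def eq_fract)
qed

abbreviation fls_of_poly :: "complex poly \<Rightarrow> complex fls" where
  "fls_of_poly p \<equiv> fps_to_fls (fps_of_poly p)"

abbreviation fract_const :: "complex \<Rightarrow> complex poly fract" where
  "fract_const c \<equiv> to_fract [:c:]"

abbreviation fract_X :: "complex poly fract" where
  "fract_X \<equiv> to_fract [:0, 1:]"

lemma idom_embedding_fls_of_poly: "idom_embedding fls_of_poly"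
  by unfold_locales (simp_all add: fps_of_poly_add fps_of_poly_mult fls_times_fps_to_fls)

interpretation fract_const: idom_embedding fract_const
  by unfold_locales (simp_all flip: to_fract_add to_fract_mult one_pCons)

lemma poly_map_poly_fract_const: "poly (map_poly fract_const p) fract_X = to_fract p"
proof (induction p)
  case (pCons a p)
  have "pCons a p = [:a:] + [:0, 1:] * p"
    by simp
  then have "to_fract (pCons a p) = fract_const a + fract_X * to_fract p"
    by (simp only: to_fract_add to_fract_mult)
  with pCons show ?case
    by (simp add: map_poly_pCons)
qed simp

lemma poly_at_inverse_t_eq_reflect_poly:
  "fract_X ^ degree p * poly_at_inverse_t p = to_fract (reflect_poly p)"
proof -
  have "fract_X ^ degree p * poly_at_inverse_t p = poly (reflect_poly (map_poly fract_const p)) fract_X"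
    by (simp add: poly_at_inverse_t_def poly_reflect_poly_nz fract_const.degree_map_poly_hom inverse_eq_divide)
  then show ?thesis
    by (simp add: fract_const.reflect_poly_map_poly_hom poly_map_poly_fract_const)
qed

lemma idom_embedding_poly_at_inverse_t: "idom_embedding poly_at_inverse_t"
proof
  show "poly_at_inverse_t p \<noteq> 0" if "p \<noteq> 0" for p
    using that poly_at_inverse_t_eq_reflect_poly[of p] by auto
  show "poly_at_inverse_t 1 = 1"
    by (simp add: poly_at_inverse_t_def flip: one_pCons)
qed (simp_all add: poly_at_inverse_t_def fract_const.map_poly_hom_add fract_const.map_poly_hom_mult)

lemma ratfun_to_fls_eq_fract_lift: "ratfun_to_fls = fract_lift fls_of_poly"
  by (simp add: fun_eq_iff ratfun_to_fls_def fract_lift_def)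

lemma ratfun_at_inverse_t_eq_fract_lift: "ratfun_at_inverse_t = fract_lift poly_at_inverse_t"
  by (simp add: fun_eq_iff ratfun_at_inverse_t_def fract_lift_def)

interpretation expansion: field_embedding ratfun_to_fls
  unfolding ratfun_to_fls_eq_fract_lift
  by (rule field_embedding_fract_lift[OF idom_embedding_fls_of_poly])

interpretation inversion: field_embedding ratfun_at_inverse_t
  unfolding ratfun_at_inverse_t_eq_fract_lift
  by (rule field_embedding_fract_lift[OF idom_embedding_poly_at_inverse_t])

lemma ratfun_to_fls_const: "ratfun_to_fls (fract_const c) = fls_const c"
  by (simp add: ratfun_to_fls_eq_fract_lift fract_lift_to_fract[OF idom_embedding_fls_of_poly] fps_of_poly_const)

lemma ratfun_to_fls_X: "ratfun_to_fls fract_X = fls_X"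
  by (simp add: ratfun_to_fls_eq_fract_lift fract_lift_to_fract[OF idom_embedding_fls_of_poly] fps_of_poly_pCons)

lemma ratfun_at_inverse_t_const: "ratfun_at_inverse_t (fract_const c) = fract_const c"
  by (simp add: ratfun_at_inverse_t_eq_fract_lift fract_lift_to_fract[OF idom_embedding_poly_at_inverse_t]
      poly_at_inverse_t_def map_poly_pCons)

lemma ratfun_at_inverse_t_X: "ratfun_at_inverse_t fract_X = inverse fract_X"
  by (simp add: ratfun_at_inverse_t_eq_fract_lift fract_lift_to_fract[OF idom_embedding_poly_at_inverse_t]
      poly_at_inverse_t_def map_poly_pCons inverse_eq_divide flip: one_pCons)

subsection \<open>Reciprocity for Laurent series\<close>

lemma fls_nth_back_diff_funpow:
  fixes F :: "'a::comm_ring_1 fls"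
  shows "fls_nth ((1 - fls_X_intpow m) ^ k * F) = (back_diff m ^^ k) (fls_nth F)"
proof (induction k)
  case (Suc k)
  have "(1 - fls_X_intpow m) ^ Suc k * F =
      (1 - fls_X_intpow m) ^ k * F - fls_X_intpow m * ((1 - fls_X_intpow m) ^ k * F)"
    by (simp add: algebra_simps)
  with Suc show ?case
    by (simp add: fun_eq_iff fls_X_intpow_times_conv_shift(1) back_diff_def)
qed simp

lemma fls_eq_sum_X_intpow:
  fixes F :: "'a::semiring_1 fls"
  assumes "finite S" "\<And>d. d \<notin> S \<Longrightarrow> fls_nth F d = 0"
  shows "F = (\<Sum>d\<in>S. fls_const (fls_nth F d) * fls_X_intpow d)"
proof (rule fls_eqI)
  fix n
  have "(\<Sum>d\<in>S. fls_nth (fls_const (fls_nth F d) * fls_X_intpow d) n) = (\<Sum>d\<in>S. if d = n then fls_nth F d else 0)"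
    by (intro sum.cong refl) simp
  then show "fls_nth F n = fls_nth (\<Sum>d\<in>S. fls_const (fls_nth F d) * fls_X_intpow d) n"
    using assms by (auto simp: fls_nth_sum)
qed

lemma one_minus_fls_X_intpow_nonzero:
  assumes "m \<noteq> 0"
  shows "1 - fls_X_intpow m \<noteq> (0 :: 'a::comm_ring_1 fls)"
proof
  assume "1 - fls_X_intpow m = (0 :: 'a fls)"
  then have "fls_nth (1 - fls_X_intpow m :: 'a fls) 0 = 0"
    by simp
  with assms show False
    by simp
qed

proposition rational_reciprocity:
  assumes "m \<noteq> 0"
    and "(back_diff m ^^ k) (fls_nth F) = (back_diff m ^^ k) (\<lambda>d. fls_nth G (- d))"
  shows "\<exists>R. ratfun_to_fls R = F \<and> ratfun_to_fls (ratfun_at_inverse_t R) = G"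
proof -
  define F' where "F' = (1 - fls_X_intpow m) ^ k * F"
  define G' where "G' = (1 - fls_X_intpow (- m)) ^ k * G"
  have reflected: "fls_nth G' (- d) = fls_nth F' d" for d
    using assms(2) unfolding F'_def G'_def fls_nth_back_diff_funpow back_diff_funpow_reflect by simp
  define S where "S = {fls_subdegree F'..- fls_subdegree G'}"
  have F'_outside: "fls_nth F' d = 0" if "d \<notin> S" for d
    using that reflected[of d] by (cases "d < fls_subdegree F'") (auto simp: S_def)
  then have F'_sum: "F' = (\<Sum>d\<in>S. fls_const (fls_nth F' d) * fls_X_intpow d)"
    by (intro fls_eq_sum_X_intpow) (simp_all add: S_def)
  have "G' = (\<Sum>d\<in>uminus ` S. fls_const (fls_nth G' d) * fls_X_intpow d)"
    using F'_outside reflected[of "- d" for d]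
    by (intro fls_eq_sum_X_intpow) (force simp: S_def image_iff)+
  then have G'_sum: "G' = (\<Sum>d\<in>S. fls_const (fls_nth F' d) * fls_X_intpow (- d))"
    by (simp add: sum.reindex inj_on_def reflected)
  define R where "R = (\<Sum>d\<in>S. fract_const (fls_nth F' d) * fract_X powi d) / (1 - fract_X powi m) ^ k"
  have "ratfun_to_fls R = F' / (1 - fls_X_intpow m) ^ k"
    by (subst F'_sum) (simp add: R_def expansion.hom_field_simps ratfun_to_fls_const ratfun_to_fls_X)
  moreover have "ratfun_at_inverse_t R =
      (\<Sum>d\<in>S. fract_const (fls_nth F' d) * fract_X powi (- d)) / (1 - fract_X powi (- m)) ^ k"
    by (simp add: R_def inversion.hom_field_simps ratfun_at_inverse_t_const ratfun_at_inverse_t_X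
        power_int_inverse power_int_minus)
  then have "ratfun_to_fls (ratfun_at_inverse_t R) = G' / (1 - fls_X_intpow (- m)) ^ k"
    by (subst G'_sum) (simp add: expansion.hom_field_simps ratfun_to_fls_const ratfun_to_fls_X)
  ultimately have "ratfun_to_fls R = F" "ratfun_to_fls (ratfun_at_inverse_t R) = G"
    using one_minus_fls_X_intpow_nonzero[of m, where ?'a = complex]
      one_minus_fls_X_intpow_nonzero[of "- m", where ?'a = complex] assms(1)
    by (simp_all add: F'_def G'_def)
  then show ?thesis
    by blast
qed

section \<open>Counting lattice points by height\<close>

text \<open>As \<open>d\<close> and \<open>z\<close> vary, the points \<open>(d + \<alpha>, z - v)\<close> run through a coset of the lattice of
  \<open>\<real> \<times> \<real>\<^sup>n\<close>; moving \<open>v\<close> and \<open>\<alpha>\<close> into the lattice keeps the cone at the origin.\<close>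

definition has_height_sums ::
    "real ^ 'n \<Rightarrow> real \<Rightarrow> (real \<times> (real ^ 'n) \<Rightarrow> real) \<Rightarrow> (int \<Rightarrow> complex) \<Rightarrow> bool" where
  "has_height_sums v \<alpha> \<phi> f \<longleftrightarrow>
     (\<forall>d. ((\<lambda>z. complex_of_real (\<phi> (of_int d + \<alpha>, z - v))) has_sum f d) int_lattice)"

lemma has_height_sums_cmult:
  assumes "has_height_sums v \<alpha> \<phi> f"
  shows "has_height_sums v \<alpha> (\<lambda>x. c * \<phi> x) (\<lambda>d. of_real c * f d)"
  using assms unfolding has_height_sums_def by (auto intro: has_sum_cmult_right)

lemma has_height_sums_diff:
  assumes "has_height_sums v \<alpha> \<phi> f" "has_height_sums v \<alpha> \<theta> g"
  shows "has_height_sums v \<alpha> (\<lambda>x. \<phi> x - \<theta> x) (\<lambda>d. f d - g d)"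
  unfolding has_height_sums_def
proof
  fix d
  have "((\<lambda>z. complex_of_real (\<phi> (of_int d + \<alpha>, z - v))) has_sum f d) int_lattice"
    using assms(1) by (simp add: has_height_sums_def)
  moreover have "((\<lambda>z. - complex_of_real (\<theta> (of_int d + \<alpha>, z - v))) has_sum - g d) int_lattice"
    using assms(2) by (simp add: has_height_sums_def has_sum_uminus)
  ultimately show
    "((\<lambda>z. complex_of_real (\<phi> (of_int d + \<alpha>, z - v) - \<theta> (of_int d + \<alpha>, z - v))) has_sum (f d - g d)) int_lattice"
    using has_sum_add by fastforce
qed

lemma bij_betw_int_lattice_diff:
  assumes "u \<in> int_lattice"
  shows "bij_betw (\<lambda>z. z - u) int_lattice int_lattice"
  using assms by (intro bij_betwI[where g = "\<lambda>z. z + u"]) (auto simp: int_lattice_def)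

lemma bij_betw_uminus_int_lattice: "bij_betw uminus int_lattice int_lattice"
  by (intro bij_betwI[where g = uminus]) (auto simp: int_lattice_def)

lemma has_height_sums_shift:
  assumes "has_height_sums v \<alpha> \<phi> f" and "fst w = of_int m" "snd w \<in> int_lattice"
  shows "has_height_sums v \<alpha> (\<lambda>x. \<phi> (x - w)) (\<lambda>d. f (d - m))"
  unfolding has_height_sums_def
proof
  fix d
  have "(of_int d + \<alpha>, z - v) - w = (of_int (d - m) + \<alpha>, (z - snd w) - v)" for z
    using assms(2) by (cases w) (simp add: algebra_simps)
  moreover have "((\<lambda>z. complex_of_real (\<phi> (of_int (d - m) + \<alpha>, (z - snd w) - v))) has_sum f (d - m)) int_lattice"
    using assms(1) unfolding has_height_sums_def
    by (subst has_sum_reindex_bij_betw[OF bij_betw_int_lattice_diff[OF assms(3)]]) blast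
  ultimately show "((\<lambda>z. complex_of_real (\<phi> ((of_int d + \<alpha>, z - v) - w))) has_sum f (d - m)) int_lattice"
    by simp
qed

lemma has_height_sums_reflect:
  assumes "has_height_sums v \<alpha> \<phi> f"
  shows "has_height_sums (- v) (- \<alpha>) (\<lambda>x. \<phi> (- x)) (\<lambda>d. f (- d))"
  unfolding has_height_sums_def
proof
  fix d
  have "((\<lambda>z. complex_of_real (\<phi> (of_int (- d) + \<alpha>, - z - v))) has_sum f (- d)) int_lattice"
    using assms unfolding has_height_sums_def
    by (subst has_sum_reindex_bij_betw[OF bij_betw_uminus_int_lattice]) blast
  then show "((\<lambda>z. complex_of_real (\<phi> (- (of_int d + - \<alpha>, z - - v)))) has_sum f (- d)) int_lattice"
    by simp
qed

lemma has_height_sums_iter_diff: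
  assumes "has_height_sums v \<alpha> \<phi> f"
    and "\<And>w. w \<in> set ws \<Longrightarrow> fst w = of_int m \<and> snd w \<in> int_lattice"
  shows "has_height_sums v \<alpha> (iter_diff ws \<phi>) ((back_diff m ^^ length ws) f)"
  using assms(2)
proof (induction ws)
  case (Cons w ws)
  then have "has_height_sums v \<alpha> (iter_diff ws \<phi>) ((back_diff m ^^ length ws) f)"
    by simp
  from has_height_sums_diff[OF this has_height_sums_shift[OF this]] Cons.prems show ?case
    by (simp add: back_diff_def[abs_def])
qed (simp add: assms(1))

lemma has_height_sums_0_imp_eq_0:
  assumes "has_height_sums v \<alpha> (\<lambda>_. 0) f"
  shows "f = (\<lambda>_. 0)"
  using assms unfolding has_height_sums_def by (auto intro: has_sum_unique[OF _ has_sum_0])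

lemma has_height_sums_indicator:
  assumes "\<And>s. finite {z \<in> int_lattice. (s, z - v) \<in> A}"
  shows "has_height_sums v \<alpha> (indicat_real A)
    (\<lambda>d. of_nat (card {z \<in> int_lattice. (of_int d + \<alpha>, z - v) \<in> A}))"
  unfolding has_height_sums_def
proof
  fix d :: int
  show "((\<lambda>z. complex_of_real (indicat_real A (of_int d + \<alpha>, z - v))) has_sum
      of_nat (card {z \<in> int_lattice. (of_int d + \<alpha>, z - v) \<in> A})) int_lattice"
    by (rule has_sum_finite_neutralI[OF assms[of "of_int d + \<alpha>"]]) (auto simp: indicator_def)
qed

lemma finite_bounded_int_lattice:
  fixes S :: "(real ^ 'n) set"
  assumes "bounded S"
  shows "finite (S \<inter> int_lattice)"
proof -
  obtain B where norm_le: "\<And>x. x \<in> S \<Longrightarrow> norm x \<le> B"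
    using assms by (auto simp: bounded_iff)
  define F where "F = {q \<in> \<int>. \<bar>q\<bar> \<le> B}"
  have "vec_nth x i \<in> F" if "x \<in> S \<inter> int_lattice" for x i
    using that norm_le[of x] component_le_norm_cart[of x i] by (simp add: F_def int_lattice_def)
  then have "vec_nth ` (S \<inter> int_lattice) \<subseteq> PiE UNIV (\<lambda>_. F)"
    by auto
  moreover have "finite F"
    unfolding F_def by (rule finite_abs_int_segment)
  ultimately have "finite (vec_nth ` (S \<inter> int_lattice))"
    by (meson finite_PiE finite finite_subset)
  then show ?thesis
    by (rule finite_imageD) (auto simp: inj_on_def vec_nth_inject)
qed

subsection \<open>The cone over a polytope\<close>

definition cone_over :: "'a::real_vector set \<Rightarrow> (real \<times> 'a) set" where
  "cone_over P = cone hull ({1} \<times> P)"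

lemma mem_cone_over_iff: "(s, y) \<in> cone_over P \<longleftrightarrow> y \<in> dilate s P"
  by (auto simp: cone_over_def dilate_def cone_hull_expl)

lemma mem_rel_interior_cone_over_iff:
  assumes "convex P"
  shows "(s, y) \<in> rel_interior (cone_over P) \<longleftrightarrow> y \<in> dilate_relint s P"
  using rel_interior_convex_cone_aux[OF assms, of s y] by (auto simp: cone_over_def dilate_relint_def)

lemma span_cone_hull: "span (cone hull S) = span S"
proof (intro antisym)
  have "cone (span S)"
    by (simp add: cone_def span_scale)
  then show "span (cone hull S) \<subseteq> span S"
    by (intro span_minimal hull_minimal span_superset subspace_span)
  show "span S \<subseteq> span (cone hull S)"
    by (intro span_mono hull_subset)
qed

lemma dim_cone_over:
  fixes P :: "'a::euclidean_space set"
  shows "int (dim (cone_over P)) = aff_dim P + 1"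
proof -
  define W :: "(real \<times> 'a) set" where "W = {1} \<times> P"
  have "dim (cone_over P) = dim W"
    unfolding cone_over_def W_def by (metis dim_span span_cone_hull)
  also have "int (dim W) = int (dim (insert 0 W))"
    by (simp add: dim_insert span_zero)
  also have "\<dots> = aff_dim (insert 0 W)"
    by (rule aff_dim_zero[symmetric]) (simp add: hull_inc)
  also have "\<dots> = aff_dim W + 1"
  proof -
    have "affine {x :: real \<times> 'a. fst x = 1}"
      unfolding affine_def by (auto simp flip: distrib_right)
    then have "affine hull W \<subseteq> {x. fst x = 1}"
      by (intro hull_minimal) (auto simp: W_def)
    then show ?thesis
      by (auto simp: aff_dim_insert)
  qed
  also have "aff_dim W = aff_dim P"
  proof -
    have "W = (+) (1, 0) ` Pair 0 ` P"
      by (auto simp: W_def image_image)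
    moreover have "linear (Pair 0 :: 'a \<Rightarrow> real \<times> 'a)" "inj (Pair 0 :: 'a \<Rightarrow> real \<times> 'a)"
      by (auto simp: linear_iff inj_def)
    ultimately show ?thesis
      by (simp only: aff_dim_translation_eq aff_dim_injective_linear_image)
  qed
  finally show ?thesis .
qed

lemma convex_cone_hull_scaleR_homogenize:
  fixes V :: "'a::euclidean_space set"
  assumes "V \<noteq> {}" "m > 0"
  shows "convex_cone hull ((*\<^sub>R) m ` ({1} \<times> V)) = cone_over (convex hull V)"
proof -
  have "convex_cone hull ((*\<^sub>R) m ` ({1} \<times> V)) = (*\<^sub>R) m ` (convex_cone hull ({1} \<times> V))"
    by (rule convex_cone_hull_linear_image) (simp add: linear_scaleR)
  also have "convex_cone hull ({1} \<times> V) = cone_over (convex hull V)"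
    using assms(1) by (auto simp: cone_over_def cone_hull_expl convex_cone_hull_convex_hull_nonempty convex_hull_Times)
  also have "(*\<^sub>R) m ` cone_over (convex hull V) = cone_over (convex hull V)"
    using assms cone_iff[of "cone_over (convex hull V)"] cone_cone_hull by (auto simp: cone_over_def)
  finally show ?thesis .
qed

lemma common_denominator:
  assumes "finite Q" "Q \<subseteq> \<rat>"
  shows "\<exists>m::nat. m \<ge> 1 \<and> (\<forall>q\<in>Q. real m * q \<in> \<int>)"
  using assms
proof (induction Q rule: finite_induct)
  case (insert q Q)
  then obtain m where "m \<ge> 1" and m_mult_Ints: "\<forall>q\<in>Q. real m * q \<in> \<int>"
    by auto
  obtain a b where q_eq: "q = real_of_int a / real b" "b > 0"
    using insert.prems by (auto simp: Rats_eq_int_div_nat)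
  have "real (m * b) * q = of_int (int m * a)"
    using q_eq by simp
  then have "real (m * b) * q \<in> \<int>"
    by (metis Ints_of_int)
  moreover have "real (m * b) * r \<in> \<int>" if "r \<in> Q" for r
  proof -
    have "real (m * b) * r = of_nat b * (real m * r)"
      by simp
    with m_mult_Ints that show ?thesis
      by (metis Ints_mult Ints_of_nat)
  qed
  moreover have "m * b \<ge> 1"
    using \<open>m \<ge> 1\<close> q_eq by (simp add: Suc_le_eq)
  ultimately show ?case
    by blast
qed auto

lemma rational_polytope_cone_generators:
  fixes P :: "(real ^ 'n) set"
  assumes "rational_polytope P" "P \<noteq> {}"
  obtains m :: nat and ws :: "(real \<times> (real ^ 'n)) list"
  where "m \<ge> 1" "cone_over P = convex_cone hull (set ws)"
    "\<And>w. w \<in> set ws \<Longrightarrow> fst w = real m \<and> snd w \<in> int_lattice"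
proof -
  define V where "V = {x. x extreme_point_of P}"
  have "polytope P"
    using assms(1) by (simp add: rational_polytope_def)
  then have "finite V"
    unfolding V_def by (intro finite_polyhedron_extreme_points polytope_imp_polyhedron)
  have hull: "P = convex hull V"
    unfolding V_def using \<open>polytope P\<close>
    by (intro Krein_Milman_Minkowski polytope_imp_compact polytope_imp_convex)
  define Q where "Q = (\<lambda>(x, i). x $ i) ` (V \<times> (UNIV :: 'n set))"
  have "finite Q" "Q \<subseteq> \<rat>"
    using \<open>finite V\<close> assms(1) by (auto simp: Q_def V_def rational_polytope_def)
  then obtain m :: nat where "m \<ge> 1" and m_mult_Ints: "\<forall>q\<in>Q. real m * q \<in> \<int>"
    using common_denominator by blast
  obtain ws :: "(real \<times> (real ^ 'n)) list" where ws_eq: "set ws = (*\<^sub>R) (real m) ` ({1} \<times> V)"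
    using \<open>finite V\<close> by (meson finite.emptyI finite.insertI finite_SigmaI finite_imageI finite_list)
  have "cone_over P = convex_cone hull (set ws)"
    unfolding ws_eq using hull assms(2) \<open>m \<ge> 1\<close> by (subst convex_cone_hull_scaleR_homogenize) auto
  moreover have "fst w = real m \<and> snd w \<in> int_lattice" if "w \<in> set ws" for w
    using that m_mult_Ints by (auto simp: ws_eq Q_def int_lattice_def)
  ultimately show ?thesis
    using that \<open>m \<ge> 1\<close> by blast
qed

subsection \<open>The quasi-polynomial interpolating both counting functions\<close>

lemma bounded_dilate: "bounded P \<Longrightarrow> bounded (dilate s P)"
  by (simp add: dilate_def bounded_scaling)

lemma dilate_relint_subset_dilate: "dilate_relint s P \<subseteq> dilate s P"
  using rel_interior_subset[of P] by (auto simp: dilate_def dilate_relint_def)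

lemma translation_Int_eq_Collect:
  fixes A :: "'a::ab_group_add set"
  shows "(\<lambda>x. v + x) ` A \<inter> L = {z \<in> L. z - v \<in> A}"
  by (force simp: image_iff algebra_simps)

lemma finite_dilate_int_lattice:
  fixes P :: "(real ^ 'n) set"
  assumes "bounded P"
  shows "finite {z \<in> int_lattice. z - v \<in> dilate s P}"
  using finite_bounded_int_lattice[OF bounded_translation[OF bounded_dilate[OF assms]]]
  by (simp only: translation_Int_eq_Collect)

lemma has_height_sums_cone_over:
  assumes "bounded P"
  shows "has_height_sums v \<alpha> (indicat_real (cone_over P)) (\<lambda>d. of_nat (count_pts P v \<alpha> d))"
  using has_height_sums_indicator[of v "cone_over P" \<alpha>] finite_dilate_int_lattice[OF assms, of v]
  unfolding mem_cone_over_iff count_pts_def translation_Int_eq_Collect by simp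

lemma has_height_sums_rel_interior_cone_over:
  assumes "bounded P" "convex P"
  shows "has_height_sums v \<alpha> (indicat_real (rel_interior (cone_over P)))
    (\<lambda>d. of_nat (count_relint_pts P v \<alpha> d))"
proof -
  have "finite {z \<in> int_lattice. z - v \<in> dilate_relint s P}" for s
    by (rule finite_subset[OF _ finite_dilate_int_lattice[OF assms(1)]])
      (use dilate_relint_subset_dilate in blast)
  then show ?thesis
    using has_height_sums_indicator[of v "rel_interior (cone_over P)" \<alpha>]
    unfolding mem_rel_interior_cone_over_iff[OF assms(2)] count_relint_pts_def translation_Int_eq_Collect
    by simp
qed

definition ehrhart_qpoly :: "(real ^ 'n) set \<Rightarrow> real ^ 'n \<Rightarrow> real \<Rightarrow> int \<Rightarrow> complex" where
  "ehrhart_qpoly P v \<alpha> d = of_nat (count_pts P v \<alpha> d) +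
     (- 1) ^ nat (aff_dim P) * of_nat (count_relint_pts P (- v) (- \<alpha>) (- d))"

lemma has_height_sums_reciprocity_defect:
  fixes P :: "(real ^ 'n) set"
  assumes "bounded P" "convex P" "P \<noteq> {}"
  shows "has_height_sums v \<alpha> (reciprocity_defect (cone_over P)) (ehrhart_qpoly P v \<alpha>)"
proof -
  have "\<not> aff_dim P < 0"
    using assms(3) by simp
  then have "dim (cone_over P) = Suc (nat (aff_dim P))"
    using dim_cone_over[of P] by linarith
  then have "reciprocity_defect (cone_over P) = (\<lambda>x. indicat_real (cone_over P) x -
      - ((- 1) ^ nat (aff_dim P)) * indicat_real (rel_interior (cone_over P)) (- x))"
    by (simp add: fun_eq_iff reciprocity_defect_def reflected_interior_def indicator_def)
  moreover have "ehrhart_qpoly P v \<alpha> = (\<lambda>d. of_nat (count_pts P v \<alpha> d) -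
      of_real (- ((- 1) ^ nat (aff_dim P))) * of_nat (count_relint_pts P (- v) (- \<alpha>) (- d)))"
    by (simp add: fun_eq_iff ehrhart_qpoly_def)
  moreover have "has_height_sums v \<alpha> (\<lambda>x. indicat_real (rel_interior (cone_over P)) (- x))
      (\<lambda>d. of_nat (count_relint_pts P (- v) (- \<alpha>) (- d)))"
    using has_height_sums_reflect[OF has_height_sums_rel_interior_cone_over[OF assms(1,2)], of "- v" "- \<alpha>"]
    by simp
  ultimately show ?thesis
    by (simp only:) (intro has_height_sums_diff has_height_sums_cmult has_height_sums_cone_over assms(1))
qed

proposition back_diff_funpow_ehrhart_qpoly:
  fixes P :: "(real ^ 'n) set"
  assumes "rational_polytope P" "P \<noteq> {}"
  obtains m :: nat and k
  where "m \<ge> 1" "\<And>v \<alpha>. (back_diff (int m) ^^ k) (ehrhart_qpoly P v \<alpha>) = (\<lambda>_. 0)"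
proof -
  obtain m :: nat and ws :: "(real \<times> (real ^ 'n)) list"
    where "m \<ge> 1" and cone: "cone_over P = convex_cone hull (set ws)"
    and generators: "\<And>w. w \<in> set ws \<Longrightarrow> fst w = real m \<and> snd w \<in> int_lattice"
    using rational_polytope_cone_generators[OF assms] by blast
  have "polytope P"
    using assms(1) by (simp add: rational_polytope_def)
  have "iter_diff ws (reciprocity_defect (cone_over P)) = (\<lambda>_. 0)"
    unfolding cone
  proof (rule iter_diff_reciprocity_defect)
    show "(1, 0) \<bullet> w > 0" if "w \<in> set ws" for w
      using generators[OF that] \<open>m \<ge> 1\<close> by (cases w) simp
  qed
  moreover have "has_height_sums v \<alpha> (iter_diff ws (reciprocity_defect (cone_over P)))
      ((back_diff (int m) ^^ length ws) (ehrhart_qpoly P v \<alpha>))" for v \<alpha>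
    using generators \<open>polytope P\<close> assms(2)
    by (intro has_height_sums_iter_diff has_height_sums_reciprocity_defect
        polytope_imp_bounded polytope_imp_convex) simp_all
  ultimately have "(back_diff (int m) ^^ length ws) (ehrhart_qpoly P v \<alpha>) = (\<lambda>_. 0)" for v \<alpha>
    by (intro has_height_sums_0_imp_eq_0) simp
  then show ?thesis
    using that \<open>m \<ge> 1\<close> by blast
qed

lemma quasi_polynomial_ehrhart_qpoly:
  assumes "rational_polytope P" "P \<noteq> {}"
  shows "quasi_polynomial (ehrhart_qpoly P v \<alpha>)"
  by (rule back_diff_funpow_ehrhart_qpoly[OF assms]) (rule quasi_polynomial_if_back_diff_funpow_eq_0)

lemma count_pts_eq_0: "of_int d < - \<alpha> \<Longrightarrow> count_pts P v \<alpha> d = 0"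
  by (simp add: count_pts_def dilate_def)

lemma count_relint_pts_eq_0: "of_int d \<le> - \<alpha> \<Longrightarrow> count_relint_pts P v \<alpha> d = 0"
  by (simp add: count_relint_pts_def dilate_relint_def)

lemma ehrhart_qpoly_eq_count_pts:
  assumes "of_int d \<ge> - \<alpha>"
  shows "ehrhart_qpoly P v \<alpha> d = of_nat (count_pts P v \<alpha> d)"
  using assms by (simp add: ehrhart_qpoly_def count_relint_pts_eq_0)

lemma ehrhart_qpoly_minus_eq_count_relint_pts:
  assumes "of_int d > \<alpha>"
  shows "ehrhart_qpoly P v \<alpha> (- d) = (- 1) ^ nat (aff_dim P) * of_nat (count_relint_pts P (- v) (- \<alpha>) d)"
  using assms by (simp add: ehrhart_qpoly_def count_pts_eq_0)

lemma quasi_polynomial_on_count_pts: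
  assumes "rational_polytope P" "P \<noteq> {}"
  shows "quasi_polynomial_on {d. of_int d \<ge> - \<alpha>} (\<lambda>d. of_nat (count_pts P v \<alpha> d))"
  unfolding quasi_polynomial_on_def
  using quasi_polynomial_ehrhart_qpoly[OF assms, of v \<alpha>] ehrhart_qpoly_eq_count_pts[of \<alpha> _ P v] by fastforce

lemma quasi_polynomial_on_count_relint_pts:
  assumes "rational_polytope P" "P \<noteq> {}"
  shows "quasi_polynomial_on {d. of_int d > - \<alpha>} (\<lambda>d. of_nat (count_relint_pts P v \<alpha> d))"
  unfolding quasi_polynomial_on_def
proof (intro exI conjI ballI)
  show "quasi_polynomial (\<lambda>d. (- 1) ^ nat (aff_dim P) * ehrhart_qpoly P (- v) (- \<alpha>) (- d))"
    by (intro quasi_polynomial_cmult quasi_polynomial_reflect[of "ehrhart_qpoly P (- v) (- \<alpha>)"]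
        quasi_polynomial_ehrhart_qpoly assms)
  fix d assume "d \<in> {d. of_int d > - \<alpha>}"
  then show "of_nat (count_relint_pts P v \<alpha> d) =
      (- 1) ^ nat (aff_dim P) * ehrhart_qpoly P (- v) (- \<alpha>) (- d)"
    by (simp add: ehrhart_qpoly_minus_eq_count_relint_pts)
qed

lemma fls_nth_minus_one_power: "fls_nth ((- 1) ^ n * F) d = (- 1) ^ n * fls_nth F d"
  for F :: "'a::comm_ring_1 fls"
  by (cases "even n") simp_all

lemma gen_series_reciprocity:
  assumes "rational_polytope P" "P \<noteq> {}"
  shows "\<exists>R R'. ratfun_to_fls R = gen_series P v \<alpha> \<and>
    ratfun_to_fls R' = gen_series_relint P (- v) (- \<alpha>) \<and>
    ratfun_at_inverse_t R = (- 1) ^ (nat (aff_dim P) + 1) * R'"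
proof -
  define e where "e = nat (aff_dim P) + 1"
  define G where "G = (- 1) ^ e * gen_series_relint P (- v) (- \<alpha>)"
  obtain m :: nat and k
    where "m \<ge> 1" and zero: "(back_diff (int m) ^^ k) (ehrhart_qpoly P v \<alpha>) = (\<lambda>_. 0)"
    by (rule back_diff_funpow_ehrhart_qpoly[OF assms]) blast
  have "ehrhart_qpoly P v \<alpha> = (\<lambda>d. fls_nth (gen_series P v \<alpha>) d - fls_nth G (- d))"
    unfolding G_def fls_nth_minus_one_power
    by (simp add: fun_eq_iff ehrhart_qpoly_def e_def gen_series.rep_eq gen_series_relint.rep_eq)
  from zero[unfolded this back_diff_funpow_diff]
  have "(back_diff (int m) ^^ k) (fls_nth (gen_series P v \<alpha>)) =
      (back_diff (int m) ^^ k) (\<lambda>d. fls_nth G (- d))"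
    by (simp add: fun_eq_iff)
  then obtain R where R: "ratfun_to_fls R = gen_series P v \<alpha>" "ratfun_to_fls (ratfun_at_inverse_t R) = G"
    using rational_reciprocity[of "int m" k "gen_series P v \<alpha>" G] \<open>m \<ge> 1\<close> by auto
  define R' where "R' = (- 1) ^ e * ratfun_at_inverse_t R"
  have "ratfun_to_fls R' = gen_series_relint P (- v) (- \<alpha>)"
    by (simp add: R'_def expansion.hom_field_simps R(2) G_def)
  moreover have "ratfun_at_inverse_t R = (- 1) ^ e * R'"
    by (simp add: R'_def)
  ultimately show ?thesis
    using R(1) unfolding e_def by blast
qed

lemma ehrhart_qpoly_unique:
  assumes "rational_polytope P" "P \<noteq> {}" "quasi_polynomial f"
    and "\<And>d. of_int d \<ge> - \<alpha> \<Longrightarrow> f d = of_nat (count_pts P v \<alpha> d)"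
  shows "f = ehrhart_qpoly P v \<alpha>"
proof (rule quasi_polynomial_eq_if_eventually_eq)
  have "f d = ehrhart_qpoly P v \<alpha> d" if "d \<ge> \<lceil>- \<alpha>\<rceil>" for d
    using that assms(4)[of d] ehrhart_qpoly_eq_count_pts[of \<alpha> d P v] by (simp only: ceiling_le_iff)
  then show "\<forall>\<^sub>F d in at_top. f d = ehrhart_qpoly P v \<alpha> d"
    unfolding eventually_at_top_linorder by blast
qed (use assms quasi_polynomial_ehrhart_qpoly in auto)

theorem theoremC4:
  fixes P :: "(real ^ 'n) set" and v :: "real ^ 'n" and \<alpha> :: real and M :: nat
  assumes "rational_polytope P" and "aff_dim P = int M"
  shows
    "(quasi_polynomial_on {d. real_of_int d \<ge> - \<alpha>} (\<lambda>d. of_nat (count_pts P v \<alpha> d)) \<and>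
      (\<forall>d::int. real_of_int d < - \<alpha> \<longrightarrow> count_pts P v \<alpha> d = 0)) \<and>
     (quasi_polynomial_on {d. real_of_int d > - \<alpha>} (\<lambda>d. of_nat (count_relint_pts P v \<alpha> d)) \<and>
      (\<forall>d::int. real_of_int d \<le> - \<alpha> \<longrightarrow> count_relint_pts P v \<alpha> d = 0)) \<and>
     (\<exists>R R'. ratfun_to_fls R = gen_series P v \<alpha> \<and>
             ratfun_to_fls R' = gen_series_relint P (- v) (- \<alpha>) \<and>
             ratfun_at_inverse_t R = (- 1) ^ (M + 1) * R') \<and>
     (\<forall>f. quasi_polynomial f \<and>
          (\<forall>d::int. real_of_int d \<ge> - \<alpha> \<longrightarrow> f d = of_nat (count_pts P v \<alpha> d)) \<longrightarrow>
          (\<forall>i::int. real_of_int i > \<alpha> \<longrightarrow>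
             f (- i) = (- 1) ^ M * of_nat (count_relint_pts P (- v) (- \<alpha>) i)))"
proof -
  have dim: "nat (aff_dim P) = M"
    using assms(2) by simp
  have P: "rational_polytope P" "P \<noteq> {}"
    using assms by auto
  have "f (- i) = (- 1) ^ M * of_nat (count_relint_pts P (- v) (- \<alpha>) i)"
    if "quasi_polynomial f" "\<forall>d::int. real_of_int d \<ge> - \<alpha> \<longrightarrow> f d = of_nat (count_pts P v \<alpha> d)"
      "real_of_int i > \<alpha>" for f i
    using ehrhart_qpoly_unique[OF P that(1)] that(2)
      ehrhart_qpoly_minus_eq_count_relint_pts[OF that(3), of P v] by (simp add: dim)
  then show ?thesis
    using quasi_polynomial_on_count_pts[OF P] count_pts_eq_0
      quasi_polynomial_on_count_relint_pts[OF P] count_relint_pts_eq_0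
      gen_series_reciprocity[OF P] unfolding dim by blast
qed

end
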